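(* Let $p$ be a fixed positive integer. Given any $2^p$-recognizable set $Y\subseteq\mathbb{N}$ (via a finite automaton $\mathcal{A}$ recognizing it, i.e. accepting $\mathrm{val}_{2^p}^{-1}(Y)$), it is decidable whether $Y=m\mathcal{T}$ for some $m\in\mathbb{N}$. The decision procedure can be run in time $O(N^2)$, where $N$ is the number of states of the given automaton $\mathcal{A}$.
   Context: $\mathcal{T}\subseteq\mathbb{N}$ is the Thue-Morse set, i.e. the set of natural numbers whose base-$2$ expansion has an even number of digits $1$, and $m\mathcal{T}=\{mt:t\in\mathcal{T}\}$. $A_{2^p}=\{0,\dots,2^p-1\}$; for $w=c_{\ell-1}\cdots c_0\in A_{2^p}^*$, $\mathrm{val}_{2^p}(w)=\sum_j c_j2^{pj}$; $\mathrm{val}_{2^p}^{-1}(Y)=\{w\in A_{2^p}^*:\mathrm{val}_{2^p}(w)\in Y\}$. A set $Y\subseteq\mathbb{N}$ is $2^p$-recognizable if the language $\mathrm{val}_{2^p}^{-1}(Y)$ is regular, i.e. accepted by a finite automaton. *)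

theory Defs
  imports Complex_Main "HOL-Library.Landau_Symbols"
begin

section \<open>The Thue-Morse set and recognizable sets\<close>

definition thue_morse :: "nat set" where
  "thue_morse = {n. even (card {i. bit n i})}"

definition multiples :: "nat \<Rightarrow> nat set \<Rightarrow> nat set" where
  "multiples m Y = (\<lambda>t. m * t) ` Y"

text \<open>Words are lists of digits, the most significant digit first.\<close>

definition val :: "nat \<Rightarrow> nat list \<Rightarrow> nat" where
  "val p w = (\<Sum>j<length w. (rev w ! j) * 2 ^ (p * j))"

definition val_inv :: "nat \<Rightarrow> nat set \<Rightarrow> nat list set" where
  "val_inv p Y = {w \<in> lists {..<2 ^ p}. val p w \<in> Y}"

text \<open>Complete deterministic finite automata, with states \<open>{..<nstates A}\<close>,
  over the alphabet \<open>{..<2 ^ p}\<close>.\<close>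

record dfa =
  nstates :: nat
  init :: nat
  delta :: "nat \<Rightarrow> nat \<Rightarrow> nat"
  final :: "nat set"

definition wf_dfa :: "nat \<Rightarrow> dfa \<Rightarrow> bool" where
  "wf_dfa p A \<longleftrightarrow>
     init A < nstates A \<and>
     (\<forall>q<nstates A. \<forall>a<2 ^ p. delta A q a < nstates A) \<and>
     final A \<subseteq> {..<nstates A}"

definition lang :: "nat \<Rightarrow> dfa \<Rightarrow> nat list set" where
  "lang p A = {w \<in> lists {..<2 ^ p}. foldl (delta A) (init A) w \<in> final A}"

definition recognizes :: "nat \<Rightarrow> dfa \<Rightarrow> nat set \<Rightarrow> bool" where
  "recognizes p A Y \<longleftrightarrow> wf_dfa p A \<and> lang p A = val_inv p Y"

section \<open>Random access machines\<close>

text \<open>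
  Programs are while programs over a random access memory. The memory is a family of
  arrays of natural numbers, of which a program can address only finitely many; scalar
  variables are cells with a constant index. Keeping the arrays apart instead of
  interleaving them in a single memory changes running times by a constant factor only.

  The only arithmetic operations are addition and truncated subtraction. Every operation
  has unit cost. To make this cost measure realistic, the machine has a word bound \<open>W\<close>:
  no number exceeding \<open>W\<close> may occur in a run, be it as a value, as an intermediate result
  or as an address. A program attempting to exceed the bound gets stuck.
\<close>

datatype expr =
    Const nat
  | Cell nat expr
  | Add expr expr
  | Sub expr expr

datatype prog =
    Skip
  | Assign nat expr expr
  | Seq prog prog
  | If expr prog prog
  | While expr prog

type_synonym memory = "nat \<Rightarrow> nat \<Rightarrow> nat"

fun eval_expr :: "expr \<Rightarrow> memory \<Rightarrow> nat" where
  "eval_expr (Const n) s = n"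
| "eval_expr (Cell x e) s = s x (eval_expr e s)"
| "eval_expr (Add e1 e2) s = eval_expr e1 s + eval_expr e2 s"
| "eval_expr (Sub e1 e2) s = eval_expr e1 s - eval_expr e2 s"

fun cost :: "expr \<Rightarrow> nat" where
  "cost (Const n) = 1"
| "cost (Cell x e) = 1 + cost e"
| "cost (Add e1 e2) = 1 + cost e1 + cost e2"
| "cost (Sub e1 e2) = 1 + cost e1 + cost e2"

text \<open>All numbers occurring in the evaluation of an expression are at most \<open>W\<close>.\<close>

fun fits :: "nat \<Rightarrow> expr \<Rightarrow> memory \<Rightarrow> bool" where
  "fits W (Const n) s \<longleftrightarrow> n \<le> W"
| "fits W (Cell x e) s \<longleftrightarrow> fits W e s \<and> s x (eval_expr e s) \<le> W"
| "fits W (Add e1 e2) s \<longleftrightarrow> fits W e1 s \<and> fits W e2 s \<and> eval_expr e1 s + eval_expr e2 s \<le> W"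
| "fits W (Sub e1 e2) s \<longleftrightarrow> fits W e1 s \<and> fits W e2 s"

text \<open>\<open>exec W c s t s'\<close>: with word bound \<open>W\<close>, program \<open>c\<close> started in memory \<open>s\<close> halts after
  time \<open>t\<close> in memory \<open>s'\<close>. A condition holds if its value is nonzero.\<close>

inductive exec :: "nat \<Rightarrow> prog \<Rightarrow> memory \<Rightarrow> nat \<Rightarrow> memory \<Rightarrow> bool" for W where
  Skip: "exec W Skip s 1 s"
| Assign: "\<lbrakk>fits W i s; fits W e s\<rbrakk> \<Longrightarrow>
    exec W (Assign x i e) s (1 + cost i + cost e)
      (s(x := (s x)(eval_expr i s := eval_expr e s)))"
| Seq: "\<lbrakk>exec W c1 s t1 s1; exec W c2 s1 t2 s2\<rbrakk> \<Longrightarrow> exec W (Seq c1 c2) s (t1 + t2) s2"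
| IfTrue: "\<lbrakk>fits W e s; eval_expr e s \<noteq> 0; exec W c1 s t s1\<rbrakk> \<Longrightarrow>
    exec W (If e c1 c2) s (1 + cost e + t) s1"
| IfFalse: "\<lbrakk>fits W e s; eval_expr e s = 0; exec W c2 s t s1\<rbrakk> \<Longrightarrow>
    exec W (If e c1 c2) s (1 + cost e + t) s1"
| WhileFalse: "\<lbrakk>fits W e s; eval_expr e s = 0\<rbrakk> \<Longrightarrow> exec W (While e c) s (1 + cost e) s"
| WhileTrue: "\<lbrakk>fits W e s; eval_expr e s \<noteq> 0; exec W c s t1 s1; exec W (While e c) s1 t2 s2\<rbrakk> \<Longrightarrow>
    exec W (While e c) s (1 + cost e + t1 + t2) s2"

inductive_cases exec_SkipE: "exec W Skip s t s'"
inductive_cases exec_AssignE: "exec W (Assign x i e) s t s'"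
inductive_cases exec_SeqE: "exec W (Seq c1 c2) s t s'"
inductive_cases exec_IfE: "exec W (If e c1 c2) s t s'"
inductive_cases exec_WhileE: "exec W (While e c) s t s'"

lemma exec_deterministic:
  assumes "exec W c s t s1" and "exec W c s t' s2"
  shows "t = t' \<and> s1 = s2"
  using assms
proof (induction arbitrary: t' s2 rule: exec.induct)
  case Skip
  from Skip show ?case by (rule exec_SkipE) simp
next
  case Assign
  from Assign.prems show ?case by (rule exec_AssignE) simp
next
  case Seq
  from Seq.prems show ?case by (rule exec_SeqE) (auto dest!: Seq.IH)
next
  case IfTrue
  from IfTrue.prems show ?case by (rule exec_IfE) (insert IfTrue.hyps(2), auto dest!: IfTrue.IH)
next
  case IfFalse
  from IfFalse.prems show ?case by (rule exec_IfE) (insert IfFalse.hyps(2), auto dest!: IfFalse.IH)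
next
  case WhileFalse
  from WhileFalse.prems show ?case by (rule exec_WhileE) (insert WhileFalse.hyps(2), auto)
next
  case WhileTrue
  from WhileTrue.prems show ?case by (rule exec_WhileE) (insert WhileTrue.hyps(2), auto dest!: WhileTrue.IH)
qed

section \<open>Decision procedures on automata\<close>

text \<open>Initially, array 0 holds the number of states and the initial state, array 1 the
  transition table row by row, array 2 the characteristic function of the set of final
  states, and all other cells are 0. The answer is left in cell 0 of array 3.\<close>

definition input_memory :: "nat \<Rightarrow> dfa \<Rightarrow> memory" where
  "input_memory p A =
     (\<lambda>_ _. 0)
       (0 := (\<lambda>_. 0)(0 := nstates A, 1 := init A),
        1 := (\<lambda>i. if i < nstates A * 2 ^ p then delta A (i div 2 ^ p) (i mod 2 ^ p) else 0),
        2 := (\<lambda>q. of_bool (q < nstates A \<and> q \<in> final A)))"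

text \<open>Program \<open>c\<close> decides property \<open>P\<close> of the set \<open>Y\<close> given by any automaton recognizing it,
  within time \<open>T N\<close> and with word bound \<open>W N\<close>, where \<open>N\<close> is the number of states.\<close>

definition decides ::
  "nat \<Rightarrow> (nat set \<Rightarrow> bool) \<Rightarrow> prog \<Rightarrow> (nat \<Rightarrow> nat) \<Rightarrow> (nat \<Rightarrow> nat) \<Rightarrow> bool" where
  "decides p P c T W \<longleftrightarrow>
     (\<forall>A Y. recognizes p A Y \<longrightarrow>
        (\<exists>t s. exec (W (nstates A)) c (input_memory p A) t s \<and>
               t \<le> T (nstates A) \<and>
               s 3 0 = of_bool (P Y)))"

end

theory Submission
  imports Defs
begin

text \<open>
  Write \<open>P = 2^p\<close> and \<open>m = m' * P^q\<close> with \<open>P\<close> not dividing \<open>m'\<close>, where \<open>Y\<close> consists of the multiples of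
  \<open>m \<noteq> 0\<close> by Thue--Morse numbers. Since \<open>3\<close> is the least positive Thue--Morse number, \<open>3 * m\<close> is the least
  positive element of \<open>Y\<close>. An automaton with \<open>N\<close> states must distinguish the prefixes \<open>i < k\<close>, where \<open>k\<close>
  is the odd part of \<open>m\<close>, so \<open>m' \<le> P * N\<close>; and the states on reading zeros repeat within \<open>N\<close> steps, so
  \<open>q < N\<close>. Hence \<open>m\<close> itself may be exponential in \<open>N\<close>, but searching the least \<open>q\<close> and then the least
  \<open>x \<le> P * N\<close> with \<open>3 * x * P^q \<in> Y\<close> leaves only one candidate, at a cost of \<open>O(N^2)\<close>. (If the search
  fails, the only candidate is \<open>m = 0\<close>.) The candidate is verified by exploring the product of the given
  automaton with the one for the multiplier \<open>x\<close>, whose \<open>2 x\<close> states are pairs of a remainder and a parity.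
\<close>

text \<open>The quadratic budget rules out running the automaton afresh on each of the up to
  \<open>N * (P * N)\<close> numbers tested by the search. The states reached on all numbers up to
  \<open>3 * P * N\<close> are therefore tabulated once, and an array holding, for every state, its
  successor after \<open>j\<close> zeros is advanced once per round; each test is then a constant
  number of look-ups.

  The factor \<open>P ^ q\<close>, possibly exponential, is never computed. Numbers divisible by
  \<open>P ^ q\<close> are read as a word followed by \<open>q\<close> zeros, so they are compared
  with multiplier \<open>x\<close> through the state after \<open>q\<close> further zeros. All other
  numbers end in a nonzero digit followed by fewer than \<open>q\<close> zeros, and none of them may
  be accepted. With \<open>q = N\<close> and the comparison switched off, the same test decides
  whether the set is \<open>{0}\<close>, which is the case of multiplier 0.

  The product of automata has at most \<open>2 * x * N\<close> states with
  \<open>x \<le> P * N\<close>, hence \<open>O(N^2)\<close> of them for fixed \<open>p\<close>, each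
  with \<open>P\<close> transitions. Since the machine has neither multiplication nor division,
  products and quotients come from doubling, running sums and counters.\<close>

lemma thue_morse_double: "2 * n \<in> thue_morse \<longleftrightarrow> n \<in> thue_morse"
  and thue_morse_Suc_double: "Suc (2 * n) \<in> thue_morse \<longleftrightarrow> n \<notin> thue_morse"
proof -
  have fin: "finite {i. bit n i}" for n :: nat
  proof (rule finite_subset)
    show "{i. bit n i} \<subseteq> {..n}"
    proof
      fix i assume "i \<in> {i. bit n i}"
      then have "odd (n div 2 ^ i)" by (simp add: bit_iff_odd)
      then have "n div 2 ^ i \<noteq> 0" by (metis even_zero)
      then have "2 ^ i \<le> n" by (meson div_less leI)
      then show "i \<in> {..n}" using less_exp[of i] by (simp del: less_exp)
    qed
  qed simp
  have "{i. bit (2 * n) i} = Suc ` {i. bit n i}"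
  proof (rule set_eqI)
    fix i show "i \<in> {i. bit (2 * n) i} \<longleftrightarrow> i \<in> Suc ` {i. bit n i}"
      by (cases i) (auto simp: bit_Suc bit_0)
  qed
  then show "2 * n \<in> thue_morse \<longleftrightarrow> n \<in> thue_morse"
    by (simp add: thue_morse_def card_image)
  have "{i. bit (Suc (2 * n)) i} = insert 0 (Suc ` {i. bit n i})"
  proof (rule set_eqI)
    fix i show "i \<in> {i. bit (Suc (2 * n)) i} \<longleftrightarrow> i \<in> insert 0 (Suc ` {i. bit n i})"
      by (cases i) (auto simp: bit_Suc bit_0)
  qed
  then show "Suc (2 * n) \<in> thue_morse \<longleftrightarrow> n \<notin> thue_morse"
    by (simp add: thue_morse_def card_image fin)
qed

lemma zero_in_thue_morse: "0 \<in> thue_morse"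
proof -
  have "{i. bit (0::nat) i} = {}" by auto
  then show ?thesis by (simp only: thue_morse_def mem_Collect_eq card.empty even_zero)
qed

lemma three_in_thue_morse: "3 \<in> thue_morse"
  using thue_morse_Suc_double[of 0] thue_morse_Suc_double[of 1] zero_in_thue_morse
  by (simp add: numeral_eq_Suc)

lemma thue_morse_ge_3:
  assumes "t \<in> thue_morse" "t \<noteq> 0"
  shows "3 \<le> t"
proof (rule ccontr)
  assume "\<not> 3 \<le> t"
  then have "t = 1 \<or> t = 2" using assms(2) by linarith
  then show False
    using assms(1) thue_morse_Suc_double[of 0] thue_morse_double[of 1] zero_in_thue_morse by auto
qed

section \<open>Digit parity and the automaton of a multiplier\<close>

definition tm :: "nat \<Rightarrow> nat" where
  "tm n = of_bool (n \<notin> thue_morse)"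

lemma tm_0 [simp]: "tm 0 = 0"
  by (simp add: tm_def zero_in_thue_morse)

lemma tm_double: "tm (2 * n) = tm n"
  and tm_Suc_double: "tm (Suc (2 * n)) = 1 - tm n"
  by (auto simp: tm_def thue_morse_double thue_morse_Suc_double)

lemma tm_le_1: "tm n \<le> 1"
  by (simp add: tm_def)

text \<open>Writing the \<open>p\<close> binary digits of \<open>d\<close> after those of
  \<open>e\<close> adds the numbers of ones, so the parities add modulo 2. The induction splits the
  lowest bit off \<open>d\<close>.\<close>

lemma tm_append:
  assumes "d < 2 ^ p"
  shows "tm (e * 2 ^ p + d) = (if tm d = 0 then tm e else 1 - tm e)"
  using assms
proof (induction p arbitrary: d)
  case (Suc p)
  define d' where "d' = d div 2"
  have d': "d' < 2 ^ p" using Suc.prems by (auto simp: d'_def)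
  have "d = 2 * d' \<or> d = Suc (2 * d')" by (auto simp: d'_def)
  moreover have "tm (e * 2 ^ Suc p + 2 * d') = tm (e * 2 ^ p + d')"
    using tm_double[of "e * 2 ^ p + d'"] by (simp add: algebra_simps)
  moreover have "tm (e * 2 ^ Suc p + Suc (2 * d')) = 1 - tm (e * 2 ^ p + d')"
    using tm_Suc_double[of "e * 2 ^ p + d'"] by (simp add: algebra_simps)
  ultimately show ?case
    using Suc.IH[OF d'] tm_le_1[of e] tm_le_1[of d'] tm_double[of d'] tm_Suc_double[of d']
    by (auto simp: le_Suc_eq)
qed simp

text \<open>The state reached on input \<open>x\<close> in the automaton for multiplier \<open>m\<close>: the remainder modulo \<open>m\<close> together
  with the Thue--Morse parity of the quotient, encoded as a number below \<open>2 m\<close>.\<close>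

definition sig :: "nat \<Rightarrow> nat \<Rightarrow> nat" where
  "sig m x = x mod m + m * tm (x div m)"

lemma sig_0 [simp]: "sig m 0 = 0"
  by (simp add: sig_def)

lemma sig_less: "0 < m \<Longrightarrow> sig m x < 2 * m"
  using tm_le_1[of "x div m"] mod_less_divisor[of m x]
  by (auto simp: sig_def le_Suc_eq simp del: mod_less_divisor)

lemma sig_eq_0_iff:
  assumes "0 < m"
  shows "sig m x = 0 \<longleftrightarrow> x \<in> multiples m thue_morse"
  using assms by (auto simp: sig_def multiples_def tm_def image_iff dvd_def mod_eq_0_iff_dvd)

text \<open>Long division by \<open>m\<close>: with \<open>x = m * e + r\<close> and
  \<open>r * 2 ^ p + a = m * d + r'\<close>, the new quotient is \<open>e * 2 ^ p + d\<close> with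
  \<open>d < 2 ^ p\<close>, whose parity depends on \<open>e\<close> only through
  \<open>tm e\<close>. The code \<open>sig m x\<close> is itself a number with remainder
  \<open>r\<close> and quotient \<open>tm e\<close>, and \<open>tm (tm e) = tm e\<close>; so a code
  can be fed back into \<open>sig\<close> as if it were the input read so far.\<close>

lemma sig_step:
  assumes m: "0 < m" and a: "a < 2 ^ p"
  shows "sig m (sig m x * 2 ^ p + a) = sig m (x * 2 ^ p + a)"
proof -
  define e r where "e = x div m" and "r = x mod m"
  define d r' where "d = (r * 2 ^ p + a) div m" and "r' = (r * 2 ^ p + a) mod m"
  have r: "r < m" using m by (simp add: r_def)
  have x: "x = m * e + r" by (simp add: e_def r_def)
  have ra: "r * 2 ^ p + a = m * d + r'" by (simp add: d_def r'_def)
  have r': "r' < m" using m by (simp add: r'_def)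
  have "r * 2 ^ p + a < m * 2 ^ p"
  proof -
    have "r * 2 ^ p + a < (r + 1) * 2 ^ p" using a by simp
    also have "\<dots> \<le> m * 2 ^ p" using r by (intro mult_le_mono1) simp
    finally show ?thesis .
  qed
  then have d: "d < 2 ^ p" using m by (simp add: d_def div_less_iff_less_mult mult.commute)
  have key: "sig m ((m * f + r) * 2 ^ p + a) = r' + m * tm (f * 2 ^ p + d)" for f
  proof -
    have "(m * f + r) * 2 ^ p + a = m * (f * 2 ^ p + d) + r'"
      using ra by (simp add: algebra_simps)
    then show ?thesis using r' by (simp add: sig_def)
  qed
  have "sig m x = m * tm e + r" by (simp add: sig_def e_def r_def)
  moreover have "tm (tm e) = tm e"
    using tm_le_1[of e] tm_Suc_double[of 0] by (auto simp: le_Suc_eq)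
  ultimately show ?thesis
    using key[of "tm e"] key[of e] x tm_append[OF d, of e] tm_append[OF d, of "tm e"] by simp
qed

section \<open>Words and their values\<close>

lemma val_Nil [simp]: "val p [] = 0"
  by (simp add: val_def)

lemma val_snoc: "val p (u @ [a]) = val p u * 2 ^ p + a"
proof -
  have "val p (u @ [a]) = (\<Sum>j<Suc (length u). ((a # rev u) ! j) * 2 ^ (p * j))"
    by (simp add: val_def)
  also have "\<dots> = a + (\<Sum>j<length u. (rev u ! j) * 2 ^ (p * Suc j))"
    by (subst sum.lessThan_Suc_shift) simp
  also have "\<dots> = val p u * 2 ^ p + a"
    by (simp add: val_def sum_distrib_right power_add mult.assoc) (simp add: mult.commute)
  finally show ?thesis .
qed

lemma val_append: "val p (u @ w) = val p u * (2 ^ p) ^ length w + val p w"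
proof (induction w rule: rev_induct)
  case (snoc a w)
  then show ?case
    using val_snoc[of p "u @ w" a] by (simp add: val_snoc algebra_simps)
qed simp

lemma val_replicate_0 [simp]: "val p (replicate j 0) = 0"
  by (simp add: val_def)

lemma word_of_length:
  assumes "v < (2 ^ p) ^ l"
  shows "\<exists>u \<in> lists {..<2 ^ p}. length u = l \<and> val p u = v"
  using assms
proof (induction l arbitrary: v)
  case (Suc l)
  have "v div 2 ^ p < (2 ^ p) ^ l"
    using Suc.prems by (simp add: div_less_iff_less_mult mult.commute)
  then obtain u where u: "u \<in> lists {..<2 ^ p}" "length u = l" "val p u = v div 2 ^ p"
    using Suc.IH by blast
  show ?case
    by (rule bexI[of _ "u @ [v mod 2 ^ p]"]) (use u in \<open>simp_all add: val_snoc div_mult_mod_eq\<close>)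
qed auto

lemma ex_word:
  assumes "0 < p"
  shows "\<exists>w \<in> lists {..<2 ^ p}. val p w = v"
proof -
  have "v < 2 ^ v" by (rule less_exp)
  also have "\<dots> \<le> (2 ^ p) ^ v" using assms by (intro power_mono) (auto simp: self_le_power)
  finally show ?thesis using word_of_length by blast
qed

lemma odd_part:
  assumes "(m::nat) \<noteq> 0"
  shows "\<exists>z k. m = k * 2 ^ z \<and> odd k"
  using assms
proof (induction m rule: less_induct)
  case (less m)
  show ?case
  proof (cases "odd m")
    case True
    then show ?thesis by (intro exI[of _ 0] exI[of _ m]) simp
  next
    case False
    then obtain n where n: "m = 2 * n" by blast
    then have "n < m" "n \<noteq> 0" using less.prems by auto
    from less.IH[OF this] obtain z k where "n = k * 2 ^ z" "odd k" by blast
    then show ?thesis using n by (intro exI[of _ "Suc z"] exI[of _ k]) simp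
  qed
qed

section \<open>Automata recognizing multiples of the Thue--Morse set\<close>

locale recognizer =
  fixes p :: nat and A :: dfa and Y :: "nat set"
  assumes p: "0 < p" and rec: "recognizes p A Y"
begin

abbreviation "P \<equiv> (2::nat) ^ p"
abbreviation "N \<equiv> nstates A"
abbreviation "words \<equiv> lists {..<P}"

definition reach :: "nat list \<Rightarrow> nat" where
  "reach w = foldl (delta A) (init A) w"

definition zeros :: "nat \<Rightarrow> nat \<Rightarrow> nat" where
  "zeros j s = ((\<lambda>s. delta A s 0) ^^ j) s"

text \<open>Meant for a state entered by a nonzero digit: acceptance after \<open>j < q\<close>
  zeros then exhibits an element of \<open>Y\<close> that is not divisible by
  \<open>P ^ q\<close>.\<close>

definition hit :: "nat \<Rightarrow> nat \<Rightarrow> bool" where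
  "hit q s \<longleftrightarrow> (\<exists>j<q. zeros j s \<in> final A)"

lemma P_ge_2: "2 \<le> P"
  using p by (simp add: self_le_power)

lemma init_less: "init A < N"
  and delta_less: "s < N \<Longrightarrow> a < P \<Longrightarrow> delta A s a < N"
  using rec by (auto simp: recognizes_def wf_dfa_def)

lemma N_pos: "0 < N"
  using init_less by simp

lemma reach_Nil [simp]: "reach [] = init A"
  by (simp add: reach_def)

lemma reach_snoc: "reach (w @ [a]) = delta A (reach w) a"
  by (simp add: reach_def)

lemma reach_append_cong: "reach u = reach w \<Longrightarrow> reach (u @ v) = reach (w @ v)"
  by (simp add: reach_def)

lemma reach_less: "w \<in> words \<Longrightarrow> reach w < N"
proof (induction w rule: rev_induct)
  case (snoc a w)
  then show ?case by (simp add: reach_snoc delta_less)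
qed (simp add: init_less)

section \<open>Reading zeros, and bounds on the multiplier\<close>

lemma zeros_0 [simp]: "zeros 0 s = s"
  and zeros_Suc: "zeros (Suc j) s = delta A (zeros j s) 0"
  by (simp_all add: zeros_def)

lemma zeros_less: "s < N \<Longrightarrow> zeros j s < N"
  by (induction j) (simp_all add: zeros_Suc delta_less)

lemma reach_zeros: "reach (w @ replicate j 0) = zeros j (reach w)"
proof (induction j)
  case (Suc j)
  have "w @ replicate (Suc j) 0 = (w @ replicate j 0) @ [0]"
    by (simp add: replicate_append_same)
  then show ?case using Suc by (simp only: reach_snoc zeros_Suc)
qed simp

lemma final_iff: "w \<in> words \<Longrightarrow> reach w \<in> final A \<longleftrightarrow> val p w \<in> Y"
  using rec by (auto simp: recognizes_def lang_def val_inv_def reach_def set_eq_iff)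

lemma final_zeros_iff:
  assumes "w \<in> words"
  shows "zeros j (reach w) \<in> final A \<longleftrightarrow> val p w * P ^ j \<in> Y"
proof -
  have "w @ replicate j 0 \<in> words" using assms by auto
  from final_iff[OF this] show ?thesis by (simp add: val_append reach_zeros)
qed

text \<open>For the least \<open>j\<close> reaching the given state, the states after
  \<open>0, ..., j\<close> zeros are distinct, since a repetition could be cut out to give a smaller
  index. So \<open>j + 1 \<le> N\<close>.\<close>

lemma zeros_orbit:
  assumes "s < N"
  shows "\<exists>j<N. zeros j s = zeros i s"
proof -
  define j where "j = (LEAST j. zeros j s = zeros i s)"
  have j: "zeros j s = zeros i s"
    unfolding j_def by (rule LeastI) simp
  have le: "j \<le> k" if "zeros k s = zeros i s" for k
    unfolding j_def using that by (rule Least_le)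
  have shift: "zeros (a + c) s = zeros (b + c) s" if "zeros a s = zeros b s" for a b c
    using that by (induction c) (simp_all add: zeros_Suc)
  have "inj_on (\<lambda>k. zeros k s) {..j}"
  proof (rule linorder_inj_onI)
    fix a b assume ab: "a < b" "a \<in> {..j}" "b \<in> {..j}"
    show "zeros a s \<noteq> zeros b s"
    proof
      assume "zeros a s = zeros b s"
      from shift[OF this, of "j - b"] have "zeros (a + (j - b)) s = zeros i s" using ab j by simp
      from le[OF this] ab show False by simp
    qed
  qed auto
  then have "card {..j} \<le> card {..<N}"
    by (rule card_inj_on_le) (auto simp: zeros_less assms)
  then show ?thesis using j by (auto simp: Suc_le_eq)
qed

text \<open>Words with distinct values \<open>i < j < k\<close> lead to distinct states. Otherwise,
  extend the word of \<open>i\<close> by a suffix of length \<open>l\<close> to the value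
  \<open>m * t\<close> with \<open>t\<close> Thue-Morse; the same suffix takes the word of
  \<open>j\<close> into \<open>Y\<close>, hence to a multiple of \<open>m\<close>. The difference
  \<open>(j - i) * P ^ l\<close> is then divisible by \<open>k\<close>, and \<open>k\<close> is
  coprime to \<open>P\<close> because it is odd, so \<open>k\<close> divides
  \<open>j - i < k\<close>.\<close>

lemma odd_factor_le:
  assumes Y: "Y = multiples m thue_morse" and m: "m = k * 2 ^ z" and k: "odd k"
  shows "k \<le> N"
proof -
  have m0: "0 < m" using m k by (auto intro: Nat.gr0I)
  define wd where "wd i = (SOME w. w \<in> words \<and> val p w = i)" for i
  have wd: "wd i \<in> words" "val p (wd i) = i" for i
    using someI_ex[of "\<lambda>w. w \<in> words \<and> val p w = i"] ex_word[OF p, of i]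
    unfolding wd_def by blast+
  have "inj_on (\<lambda>i. reach (wd i)) {..<k}"
  proof (rule linorder_inj_onI)
    fix i j assume ij: "i < j" "i \<in> {..<k}" "j \<in> {..<k}"
    show "reach (wd i) \<noteq> reach (wd j)"
    proof
      assume eq: "reach (wd i) = reach (wd j)"
      \<comment> \<open>The \<open>P ^ l\<close> values available after prefix \<open>i\<close> must
        include both \<open>m * (2 * n)\<close> and \<open>m * (2 * n + 1)\<close> for the
        \<open>n\<close> chosen below. The former lies less than \<open>2 * m\<close> above the
        start of the block, so a block of length at least \<open>3 * m\<close> is long
        enough.\<close>
      define l where "l = 3 * m"
      have l: "3 * m \<le> P ^ l"
      proof -
        have "l < 2 ^ l" by (rule less_exp)
        also have "\<dots> \<le> P ^ l" using P_ge_2 by (intro power_mono) auto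
        finally show ?thesis by (simp add: l_def)
      qed
      \<comment> \<open>Of any two consecutive numbers \<open>2 n\<close>, \<open>2 n + 1\<close>, one is in the Thue--Morse set.\<close>
      define n where "n = (i * P ^ l + 2 * m - 1) div (2 * m)"
      have n: "i * P ^ l \<le> 2 * m * n" "2 * m * n < i * P ^ l + 2 * m"
      proof -
        have *: "2 * m * n + (i * P ^ l + 2 * m - 1) mod (2 * m) = i * P ^ l + 2 * m - 1"
          by (simp add: n_def)
        have "(i * P ^ l + 2 * m - 1) mod (2 * m) < 2 * m" using m0 by simp
        with * m0 show "i * P ^ l \<le> 2 * m * n" "2 * m * n < i * P ^ l + 2 * m" by linarith+
      qed
      obtain t where t: "t \<in> thue_morse" "t = 2 * n \<or> t = Suc (2 * n)"
        using thue_morse_double[of n] thue_morse_Suc_double[of n] by blast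
      have mt: "i * P ^ l \<le> m * t" "m * t < i * P ^ l + P ^ l"
        using t(2) n l m0 by (auto simp: mult.assoc mult.left_commute)
      have "m * t - i * P ^ l < P ^ l" using mt by linarith
      then obtain u where u: "u \<in> words" "length u = l" "val p u = m * t - i * P ^ l"
        using word_of_length by blast
      have "val p (wd i @ u) = m * t" using u mt wd by (simp add: val_append)
      then have "reach (wd i @ u) \<in> final A"
        using final_iff[of "wd i @ u"] wd u t by (auto simp: Y multiples_def)
      then have "reach (wd j @ u) \<in> final A" using reach_append_cong[OF eq] by simp
      then have "val p (wd j @ u) \<in> Y" using final_iff[of "wd j @ u"] wd u by auto
      then obtain t' where t': "j * P ^ l + (m * t - i * P ^ l) = m * t'"
        using wd u by (auto simp: val_append Y multiples_def)
      have "(j - i) * P ^ l + m * t = m * t'"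
        using t' mt(1) ij(1) by (simp add: diff_mult_distrib)
      then have "m dvd (j - i) * P ^ l"
        using dvd_add_left_iff[of m "m * t" "(j - i) * P ^ l"] by simp
      moreover have "k dvd m" by (simp add: m)
      ultimately have "k dvd (j - i) * P ^ l" by (rule dvd_trans[rotated])
      moreover have "coprime k (P ^ l)" using k by simp
      ultimately have "k dvd j - i" by (simp add: coprime_dvd_mult_left_iff)
      then show False using ij by (auto dest: dvd_imp_le)
    qed
  qed auto
  then have "card {..<k} \<le> card {..<N}"
    by (rule card_inj_on_le) (auto simp: reach_less wd)
  then show ?thesis by simp
qed

text \<open>Dividing the exponent of 2 in \<open>m\<close> by \<open>p\<close> leaves fewer than
  \<open>p\<close> twos with the odd part, which gives the factor \<open>P\<close> in the bound on
  \<open>m'\<close>. For \<open>q\<close>, the state after \<open>3 * m'\<close> and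
  \<open>q\<close> zeros already occurs after some \<open>j < N\<close> zeros, so
  \<open>3 * m' * P ^ j\<close> is in \<open>Y\<close> and divisible by \<open>m' * P ^ q\<close>.
  As 3 is coprime to \<open>P\<close>, this forces \<open>q \<le> j\<close>.\<close>

lemma multiplier_bounds:
  assumes Y: "Y = multiples m thue_morse" and "m \<noteq> 0"
  shows "\<exists>m' q. m = m' * P ^ q \<and> 0 < m' \<and> m' \<le> P * N \<and> q < N"
proof -
  obtain z k where m: "m = k * 2 ^ z" "odd k"
    using odd_part[OF \<open>m \<noteq> 0\<close>] by blast
  define q m' where "q = z div p" and "m' = k * 2 ^ (z mod p)"
  have "k \<le> N" using odd_factor_le[OF Y, of k z] m by (simp add: mult.commute)
  moreover have "(2::nat) ^ (z mod p) \<le> P" using p by (intro power_increasing) auto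
  ultimately have 1: "m' \<le> P * N" unfolding m'_def by (metis mult.commute mult_le_mono)
  have "z = p * q + z mod p" by (simp add: q_def)
  then have "(2::nat) ^ z = P ^ q * 2 ^ (z mod p)" by (metis power_add power_mult)
  then have 2: "m = m' * P ^ q" by (simp add: m m'_def)
  have 3: "0 < m'" using m by (auto simp: m'_def intro: Nat.gr0I)
  obtain w where w: "w \<in> words" "val p w = 3 * m'" using ex_word[OF p] by blast
  obtain j where j: "j < N" "zeros j (reach w) = zeros q (reach w)"
    using zeros_orbit[OF reach_less[OF w(1)]] by blast
  have "3 * m' * P ^ q = m * 3" using 2 by simp
  then have "3 * m' * P ^ q \<in> Y" by (auto simp: Y multiples_def intro: three_in_thue_morse)
  then have "3 * m' * P ^ j \<in> Y" using final_zeros_iff[OF w(1)] j w by metis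
  then obtain t where "m' * (3 * P ^ j) = m' * (P ^ q * t)"
    by (auto simp: Y multiples_def 2 algebra_simps)
  then have "P ^ q dvd 3 * P ^ j" using 3 by simp
  moreover have "coprime (P ^ q) 3" by (simp add: coprime_power_left_iff)
  ultimately have "P ^ q dvd P ^ j" by (simp add: coprime_dvd_mult_right_iff)
  then have "q \<le> j" using P_ge_2 by (simp add: dvd_power_iff_le)
  then show ?thesis using 1 2 3 j(1) by (intro exI[of _ m'] exI[of _ q]) auto
qed

text \<open>A true multiplier \<open>m0 = m' * P ^ q0\<close> has \<open>m'\<close> within the range
  searched, so \<open>q \<le> q0\<close> and \<open>m0 = x * P ^ q\<close>, where \<open>x\<close>
  absorbs the surplus power. Since \<open>3 * m0\<close> is the least positive element of
  \<open>Y\<close>, \<open>x \<le> m\<close>; minimality of \<open>m\<close> excludes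
  \<open>x < m\<close>. It is thus harmless that \<open>q\<close> is not known beforehand to equal
  \<open>q0\<close>.\<close>

lemma multiple_iff_found:
  assumes m: "0 < m"
    and least_q: "\<And>j x. j < q \<Longrightarrow> 1 \<le> x \<Longrightarrow> x \<le> P * N \<Longrightarrow> 3 * x * P ^ j \<notin> Y"
    and mem: "3 * m * P ^ q \<in> Y"
    and least_m: "\<And>x. 1 \<le> x \<Longrightarrow> x < m \<Longrightarrow> 3 * x * P ^ q \<notin> Y"
  shows "(\<exists>m. Y = multiples m thue_morse) \<longleftrightarrow> Y = multiples (m * P ^ q) thue_morse"
proof
  assume "\<exists>m. Y = multiples m thue_morse"
  then obtain m0 where Y: "Y = multiples m0 thue_morse" by blast
  have pos: "0 < 3 * m * P ^ q" using m by simp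
  have "m0 \<noteq> 0"
  proof
    assume "m0 = 0"
    then have "3 * m * P ^ q = 0" using mem by (auto simp: Y multiples_def)
    then show False using pos by linarith
  qed
  then obtain m' q0 where m': "m0 = m' * P ^ q0" "0 < m'" "m' \<le> P * N"
    using multiplier_bounds[OF Y] by blast
  have m0_mem: "3 * m0 \<in> Y"
    using three_in_thue_morse by (auto simp: Y multiples_def mult.commute)
  have "\<not> q0 < q"
    using least_q[of q0 m'] m' m0_mem by (auto simp: mult.assoc)
  then have q: "P ^ q0 = P ^ (q0 - q) * P ^ q" by (simp flip: power_add)
  define x where "x = m' * P ^ (q0 - q)"
  have x: "m0 = x * P ^ q" by (simp add: x_def m' q)
  have "3 * m0 \<le> 3 * m * P ^ q"
  proof -
    obtain t where t: "t \<in> thue_morse" "3 * m * P ^ q = m0 * t" using mem by (auto simp: Y multiples_def)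
    then have "t \<noteq> 0" using pos by (metis less_not_refl mult_0_right)
    then have "3 \<le> t" using t thue_morse_ge_3 by blast
    then show ?thesis using t(2) by simp
  qed
  then have "x \<le> m" by (simp add: x)
  moreover have "\<not> x < m"
    using least_m[of x] m0_mem m' by (auto simp: x x_def Suc_le_eq mult.assoc)
  ultimately have "x = m" by simp
  then show "Y = multiples (m * P ^ q) thue_morse" using Y x by simp
qed blast

lemma multiple_iff_not_found:
  assumes "\<And>j x. j < N \<Longrightarrow> 1 \<le> x \<Longrightarrow> x \<le> P * N \<Longrightarrow> 3 * x * P ^ j \<notin> Y"
  shows "(\<exists>m. Y = multiples m thue_morse) \<longleftrightarrow> Y = {0}"
proof
  assume "\<exists>m. Y = multiples m thue_morse"
  then obtain m where Y: "Y = multiples m thue_morse" by blast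
  have "m = 0"
  proof (rule ccontr)
    assume "m \<noteq> 0"
    then obtain m' q where m': "m = m' * P ^ q" "0 < m'" "m' \<le> P * N" "q < N"
      using multiplier_bounds[OF Y] by blast
    have "3 * m' * P ^ q \<in> Y"
      using three_in_thue_morse by (auto simp: Y multiples_def m' image_iff intro!: bexI[of _ 3])
    then show False using assms[of q m'] m' by simp
  qed
  then show "Y = {0}" using zero_in_thue_morse by (auto simp: Y multiples_def)
next
  assume "Y = {0}"
  then have "Y = multiples 0 thue_morse" using zero_in_thue_morse by (auto simp: multiples_def)
  then show "\<exists>m. Y = multiples m thue_morse" ..
qed

section \<open>Testing a candidate by conditions on reachable states\<close>

lemma trailing_zeros:
  "(\<exists>n. y = n * P ^ q) \<or> (\<exists>n a j. a < P \<and> a \<noteq> 0 \<and> j < q \<and> y = (n * P + a) * P ^ j)"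
proof (induction q)
  case (Suc q)
  show ?case
  proof (cases "\<exists>n. y = n * P ^ q")
    case True
    then obtain n where n: "y = n * P ^ q" by blast
    have eq: "n div P * P + n mod P = n" by (rule div_mult_mod_eq)
    show ?thesis
    proof (cases "n mod P = 0")
      case True
      with eq have "n = n div P * P" by simp
      with n have "y = n div P * P ^ Suc q" by (metis mult.assoc power_Suc)
      then show ?thesis by blast
    next
      case False
      have "n mod P < P" by simp
      then show ?thesis using False n eq by (intro disjI2 exI[of _ "n div P"] exI[of _ "n mod P"] exI[of _ q]) simp
    qed
  next
    case False
    then obtain n a j where "a < P" "a \<noteq> 0" "j < q" "y = (n * P + a) * P ^ j"
      using Suc by blast
    moreover from this have "j < Suc q" by simp
    ultimately show ?thesis by blast
  qed
qed simp

lemma hit_iff: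
  assumes "w \<in> words" "a < P"
  shows "hit q (delta A (reach w) a) \<longleftrightarrow> (\<exists>j<q. (val p w * P + a) * P ^ j \<in> Y)"
proof -
  have "w @ [a] \<in> words" using assms by auto
  from final_zeros_iff[OF this] show ?thesis by (simp add: hit_def reach_snoc val_snoc)
qed

text \<open>\<open>trailing_zeros\<close> splits the naturals in two. For \<open>n * P ^ q\<close>,
  membership in \<open>Y\<close> must agree with membership of \<open>n\<close> in the multiples of
  \<open>m\<close>, which \<open>sig m\<close> tracks; a number ending in a nonzero digit and fewer
  than \<open>q\<close> zeros must lie outside \<open>Y\<close>. Only \<open>m\<close>, not
  \<open>m * P ^ q\<close>, determines the size of the second automaton.\<close>

lemma eq_multiples_iff:
  assumes m: "0 < m"
  shows "Y = multiples (m * P ^ q) thue_morse \<longleftrightarrow>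
    (\<forall>w\<in>words. (zeros q (reach w) \<in> final A \<longleftrightarrow> sig m (val p w) = 0) \<and>
      (\<forall>a<P. a \<noteq> 0 \<longrightarrow> \<not> hit q (delta A (reach w) a)))"
    (is "_ \<longleftrightarrow> (\<forall>w\<in>words. ?R w)")
proof
  assume Y: "Y = multiples (m * P ^ q) thue_morse"
  show "\<forall>w\<in>words. ?R w"
  proof
    fix w assume w: "w \<in> words"
    have "val p w * P ^ q \<in> Y \<longleftrightarrow> val p w \<in> multiples m thue_morse"
      by (auto simp: Y multiples_def image_iff)
    moreover have "\<not> hit q (delta A (reach w) a)" if a: "a < P" "a \<noteq> 0" for a
    proof
      assume "hit q (delta A (reach w) a)"
      then obtain j t where j: "j < q" "(val p w * P + a) * P ^ j = m * P ^ q * t"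
        using hit_iff[OF w a(1)] by (auto simp: Y multiples_def)
      have "P ^ q = P ^ (q - Suc j) * P * P ^ j"
        using j(1) by (metis Suc_leI add_diff_cancel_left' le_add_diff_inverse2 mult.assoc power_Suc power_add)
      with j(2) have "(val p w * P + a) * P ^ j = (m * P ^ (q - Suc j) * t * P) * P ^ j"
        by (simp add: mult_ac)
      then have "val p w * P + a = m * P ^ (q - Suc j) * t * P" by simp
      then have "P dvd val p w * P + a" by simp
      then have "P dvd a" by simp
      then show False using a by (auto dest: dvd_imp_le)
    qed
    ultimately show "?R w" using final_zeros_iff[OF w, of q] sig_eq_0_iff[OF m] by simp
  qed
next
  assume R: "\<forall>w\<in>words. ?R w"
  have 1: "n * P ^ q \<in> Y \<longleftrightarrow> n \<in> multiples m thue_morse" for n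
  proof -
    obtain w where w: "w \<in> words" "val p w = n" using ex_word[OF p] by blast
    then show ?thesis using R final_zeros_iff[OF w(1), of q] sig_eq_0_iff[OF m] by auto
  qed
  have 2: "(n * P + a) * P ^ j \<notin> Y" if "a < P" "a \<noteq> 0" "j < q" for n a j
  proof -
    obtain w where w: "w \<in> words" "val p w = n" using ex_word[OF p] by blast
    then show ?thesis using R hit_iff[OF w(1) that(1), of q] that by blast
  qed
  show "Y = multiples (m * P ^ q) thue_morse"
  proof (intro set_eqI iffI)
    fix y assume y: "y \<in> Y"
    then obtain n where n: "y = n * P ^ q" using trailing_zeros[of y q] 2 by blast
    with y 1 obtain t where "t \<in> thue_morse" "n = m * t" by (auto simp: multiples_def)
    with n show "y \<in> multiples (m * P ^ q) thue_morse" by (auto simp: multiples_def)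
  next
    fix y assume "y \<in> multiples (m * P ^ q) thue_morse"
    then obtain t where "t \<in> thue_morse" "y = (m * t) * P ^ q" by (auto simp: multiples_def)
    then show "y \<in> Y" using 1 by (auto simp: multiples_def)
  qed
qed

lemma zero_mem_iff: "0 \<in> Y \<longleftrightarrow> init A \<in> final A"
  using final_iff[of "[]"] by simp

text \<open>Every positive number is a word ending in a nonzero digit, followed by zeros. The number
  of these zeros is unbounded, but by \<open>zeros_orbit\<close> all states they lead to appear
  within fewer than \<open>N\<close> zeros.\<close>

lemma eq_zero_iff:
  "Y = {0} \<longleftrightarrow> init A \<in> final A \<and>
    (\<forall>w\<in>words. \<forall>a<P. a \<noteq> 0 \<longrightarrow> \<not> hit N (delta A (reach w) a))"
    (is "_ \<longleftrightarrow> ?R")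
proof
  assume Y: "Y = {0}"
  then show ?R using zero_mem_iff hit_iff[of _ _ N] by auto
next
  assume R: ?R
  have "y = 0" if y: "y \<in> Y" for y
  proof (rule ccontr)
    assume "y \<noteq> 0"
    \<comment> \<open>A positive \<open>y < P ^ y\<close> is no multiple of \<open>P ^ y\<close>, so
      taking \<open>y\<close> itself as the exponent leaves only the second alternative of
      \<open>trailing_zeros\<close>.\<close>
    have "y < 2 ^ y" by (rule less_exp)
    also have "\<dots> \<le> P ^ y" using P_ge_2 by (intro power_mono) auto
    finally have "y \<noteq> n * P ^ y" for n using \<open>y \<noteq> 0\<close> by (cases n) auto
    then obtain n a i where i: "a < P" "a \<noteq> 0" "y = (n * P + a) * P ^ i"
      using trailing_zeros[of y y] by blast
    obtain w where w: "w \<in> words" "val p w = n" using ex_word[OF p] by blast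
    have wa: "w @ [a] \<in> words" using w i by simp
    obtain j where j: "j < N" "zeros j (reach (w @ [a])) = zeros i (reach (w @ [a]))"
      using zeros_orbit[OF reach_less[OF wa]] by blast
    have "zeros i (reach (w @ [a])) \<in> final A"
      using final_zeros_iff[OF wa, of i] y i w by (simp add: val_snoc)
    then have "hit N (delta A (reach w) a)" using j by (auto simp: hit_def reach_snoc)
    then show False using R w i by blast
  qed
  then show "Y = {0}" using R zero_mem_iff by blast
qed

text \<open>The outcome of the search for the multiplier: either \<open>m * P ^ q\<close> is the only candidate, or
  (flag \<open>z\<close>) the only candidate is \<open>0\<close>.\<close>

definition searched :: "bool \<Rightarrow> nat \<Rightarrow> nat \<Rightarrow> bool" where
  "searched z m q \<longleftrightarrow> 0 < m \<and>
     (\<forall>j<q. \<forall>x. 1 \<le> x \<and> x \<le> P * N \<longrightarrow> 3 * x * P ^ j \<notin> Y) \<and>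
     (if z then q = N else 3 * m * P ^ q \<in> Y \<and> (\<forall>x. 1 \<le> x \<and> x < m \<longrightarrow> 3 * x * P ^ q \<notin> Y))"

text \<open>The check made for one transition: a pair of state \<open>s\<close> and code
  \<open>b\<close>, left by digit \<open>a\<close>. The flag \<open>z\<close> disables the
  comparison with the multiplier, so that one program handles both outcomes of the search.\<close>

definition ok :: "bool \<Rightarrow> nat \<Rightarrow> nat \<Rightarrow> nat \<Rightarrow> nat \<Rightarrow> bool" where
  "ok z q s b a \<longleftrightarrow>
     (z \<or> (zeros q s \<in> final A \<longleftrightarrow> b = 0)) \<and> (a \<noteq> 0 \<longrightarrow> \<not> hit q (delta A s a))"

text \<open>The condition on \<open>init A\<close> says that 0 is in \<open>Y\<close>. It can be
  stated for both outcomes alike, as 0 belongs to every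
  \<open>multiples m thue_morse\<close>.\<close>

lemma multiple_iff_ok:
  assumes "searched z m q"
  shows "(\<exists>m. Y = multiples m thue_morse) \<longleftrightarrow>
    init A \<in> final A \<and> (\<forall>w\<in>words. \<forall>a<P. ok z q (reach w) (sig m (val p w)) a)"
proof (cases z)
  case True
  then have "(\<exists>m. Y = multiples m thue_morse) \<longleftrightarrow> Y = {0}"
    using assms unfolding searched_def by (intro multiple_iff_not_found) metis
  moreover have "q = N" using True assms by (simp add: searched_def)
  ultimately show ?thesis
    using True eq_zero_iff by (simp add: ok_def)
next
  case False
  have m: "0 < m" using assms by (simp add: searched_def)
  have "(\<exists>m. Y = multiples m thue_morse) \<longleftrightarrow> Y = multiples (m * P ^ q) thue_morse"
  proof (rule multiple_iff_found[OF m])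
    show "3 * m * P ^ q \<in> Y" using False assms by (simp add: searched_def)
  qed (use False assms in \<open>simp_all add: searched_def\<close>)
  also have "\<dots> \<longleftrightarrow> init A \<in> final A \<and> Y = multiples (m * P ^ q) thue_morse"
    using zero_in_thue_morse zero_mem_iff by (auto simp: multiples_def)
  also have "\<dots> \<longleftrightarrow> init A \<in> final A \<and>
      (\<forall>w\<in>words. \<forall>a<P. ok z q (reach w) (sig m (val p w)) a)"
  proof -
    have "0 < P" by simp
    then show ?thesis using False eq_multiples_iff[OF m, of q] unfolding ok_def by blast
  qed
  finally show ?thesis .
qed

lemma closed_pairs_eq:
  assumes m: "0 < m" and start: "(init A, 0) \<in> R"
    and closed: "\<And>s b a. (s, b) \<in> R \<Longrightarrow> a < P \<Longrightarrow> (delta A s a, sig m (b * P + a)) \<in> R"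
    and sound: "\<And>s b. (s, b) \<in> R \<Longrightarrow> \<exists>w\<in>words. s = reach w \<and> b = sig m (val p w)"
  shows "R = (\<lambda>w. (reach w, sig m (val p w))) ` words"
proof -
  have "(reach w, sig m (val p w)) \<in> R" if "w \<in> words" for w
    using that
  proof (induction w rule: rev_induct)
    case (snoc a w)
    then show ?case
      using closed[of "reach w" "sig m (val p w)" a] by (simp add: reach_snoc val_snoc sig_step[OF m])
  qed (simp add: start)
  then show ?thesis using sound by (intro set_eqI iffI) (force, blast)
qed

end

section \<open>Reasoning about programs\<close>

fun pass_cost :: "prog \<Rightarrow> nat" where
  "pass_cost Skip = 1"
| "pass_cost (Assign x i e) = 1 + cost i + cost e"
| "pass_cost (Seq c1 c2) = pass_cost c1 + pass_cost c2"
| "pass_cost (If e c1 c2) = 1 + cost e + pass_cost c1 + pass_cost c2"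
| "pass_cost (While e c) = 1 + cost e + pass_cost c"

text \<open>Time is measured in units of \<open>pass_cost c\<close>, the cost of passing once through \<open>c\<close>; in this way the
  constant factors depend on the program only.\<close>

definition run :: "nat \<Rightarrow> nat \<Rightarrow> prog \<Rightarrow> memory \<Rightarrow> (memory \<Rightarrow> bool) \<Rightarrow> bool" where
  "run W k c s Q \<longleftrightarrow> (\<exists>t s'. exec W c s t s' \<and> t \<le> k * pass_cost c \<and> Q s')"

text \<open>Weakest preconditions for loop-free code. Loops are mapped to \<open>False\<close>, so
  \<open>wp\<close> also guarantees termination within a single unit of \<open>pass_cost\<close>;
  loops are treated by \<open>run_While\<close>.\<close>

fun wp :: "nat \<Rightarrow> prog \<Rightarrow> (memory \<Rightarrow> bool) \<Rightarrow> memory \<Rightarrow> bool" where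
  "wp W Skip Q s = Q s"
| "wp W (Assign x i e) Q s =
    (fits W i s \<and> fits W e s \<and> Q (s(x := (s x)(eval_expr i s := eval_expr e s))))"
| "wp W (Seq c1 c2) Q s = wp W c1 (wp W c2 Q) s"
| "wp W (If e c1 c2) Q s =
    (fits W e s \<and> (eval_expr e s \<noteq> 0 \<longrightarrow> wp W c1 Q s) \<and> (eval_expr e s = 0 \<longrightarrow> wp W c2 Q s))"
| "wp W (While e c) Q s = False"

lemma run_mono: "run W k c s Q \<Longrightarrow> k \<le> k' \<Longrightarrow> (\<And>s'. Q s' \<Longrightarrow> Q' s') \<Longrightarrow> run W k' c s Q'"
  unfolding run_def by (meson le_trans mult_le_mono1)

lemma wp_imp_exec: "wp W c Q s \<Longrightarrow> \<exists>t s'. exec W c s t s' \<and> t \<le> pass_cost c \<and> Q s'"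
proof (induction c arbitrary: Q s)
  case Skip
  have "exec W Skip s 1 s" by (rule exec.Skip)
  then show ?case using Skip by auto
next
  case (Assign x i e)
  then show ?case by (auto intro!: exI exec.Assign)
next
  case (Seq c1 c2)
  then obtain t1 s1 where 1: "exec W c1 s t1 s1" "t1 \<le> pass_cost c1" "wp W c2 Q s1" by fastforce
  with Seq.IH(2) obtain t2 s2 where "exec W c2 s1 t2 s2" "t2 \<le> pass_cost c2" "Q s2" by blast
  with 1 have "exec W (Seq c1 c2) s (t1 + t2) s2" "t1 + t2 \<le> pass_cost (Seq c1 c2)"
    by (auto intro: exec.Seq)
  with \<open>Q s2\<close> show ?case by blast
next
  case (If e c1 c2)
  show ?case
  proof (cases "eval_expr e s = 0")
    case True
    with If obtain t s' where "exec W c2 s t s'" "t \<le> pass_cost c2" "Q s'" by fastforce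
    with True If.prems have "exec W (If e c1 c2) s (1 + cost e + t) s'"
      "1 + cost e + t \<le> pass_cost (If e c1 c2)"
      using exec.IfFalse[of W e s c2 t s' c1] by auto
    with \<open>Q s'\<close> show ?thesis by blast
  next
    case False
    with If obtain t s' where "exec W c1 s t s'" "t \<le> pass_cost c1" "Q s'" by fastforce
    with False If.prems have "exec W (If e c1 c2) s (1 + cost e + t) s'"
      "1 + cost e + t \<le> pass_cost (If e c1 c2)"
      using exec.IfTrue[of W e s c1 t s' c2] by auto
    with \<open>Q s'\<close> show ?thesis by blast
  qed
qed simp

lemma run_wp:
  assumes "wp W c Q s" "1 \<le> k"
  shows "run W k c s Q"
proof -
  have "run W 1 c s Q" using wp_imp_exec[OF assms(1)] by (simp add: run_def)
  then show ?thesis using assms(2) by (rule run_mono)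
qed

text \<open>The factor \<open>k\<close> is not doubled, because the pass costs of the two halves add
  up to that of the sequence. All phases of the program can therefore share one factor.\<close>

lemma run_Seq: "run W k c1 s (\<lambda>s1. run W k c2 s1 Q) \<Longrightarrow> run W k (Seq c1 c2) s Q"
  unfolding run_def by (fastforce simp: algebra_simps intro: exec.Seq)

lemma run_If:
  assumes "fits W e s" "1 \<le> k"
    and "eval_expr e s \<noteq> 0 \<Longrightarrow> run W k c1 s Q"
    and "eval_expr e s = 0 \<Longrightarrow> run W k c2 s Q"
  shows "run W k (If e c1 c2) s Q"
proof (cases "eval_expr e s = 0")
  case True
  with assms obtain t s' where t: "exec W c2 s t s'" "t \<le> k * pass_cost c2" "Q s'" by (auto simp: run_def)
  have "exec W (If e c1 c2) s (1 + cost e + t) s'" using assms(1) True t(1) by (rule exec.IfFalse)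
  moreover have "1 + cost e + t \<le> k * pass_cost (If e c1 c2)"
    using t(2) mult_le_mono1[OF assms(2), of "1 + cost e"] by (simp add: algebra_simps)
  ultimately show ?thesis using t(3) unfolding run_def by blast
next
  case False
  with assms obtain t s' where t: "exec W c1 s t s'" "t \<le> k * pass_cost c1" "Q s'" by (auto simp: run_def)
  have "exec W (If e c1 c2) s (1 + cost e + t) s'" using assms(1) False t(1) by (rule exec.IfTrue)
  moreover have "1 + cost e + t \<le> k * pass_cost (If e c1 c2)"
    using t(2) mult_le_mono1[OF assms(2), of "1 + cost e"] by (simp add: algebra_simps)
  ultimately show ?thesis using t(3) unfolding run_def by blast
qed

text \<open>The measure bounds the number of iterations, each of cost at most \<open>k\<close>
  passes; the summand 1 in \<open>\<mu> s + 1\<close> pays for the final, failing guard.\<close>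

lemma run_While:
  assumes I: "I s" and k: "1 \<le> k"
    and fits: "\<And>s. I s \<Longrightarrow> fits W e s"
    and step: "\<And>s. I s \<Longrightarrow> eval_expr e s \<noteq> 0 \<Longrightarrow> run W k c s (\<lambda>s'. I s' \<and> \<mu> s' < \<mu> s)"
    and post: "\<And>s. I s \<Longrightarrow> eval_expr e s = 0 \<Longrightarrow> Q s"
    and bound: "(\<mu> s + 1) * k \<le> K"
  shows "run W K (While e c) s Q"
proof -
  have "\<exists>t s'. exec W (While e c) s t s' \<and> t \<le> \<mu> s * (k * pass_cost (While e c)) + (1 + cost e) \<and> Q s'"
    using I
  proof (induction "\<mu> s" arbitrary: s rule: less_induct)
    case less
    show ?case
    proof (cases "eval_expr e s = 0")
      case True
      then have "exec W (While e c) s (1 + cost e) s"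
        using fits[OF less.prems] by (intro exec.WhileFalse)
      then show ?thesis using post[OF less.prems True] by (meson le_add2)
    next
      case False
      from step[OF less.prems this] obtain t1 s1 where
        1: "exec W c s t1 s1" "t1 \<le> k * pass_cost c" "I s1" "\<mu> s1 < \<mu> s"
        unfolding run_def by blast
      from less.hyps[OF this(4,3)] obtain t2 s2 where
        2: "exec W (While e c) s1 t2 s2" "t2 \<le> \<mu> s1 * (k * pass_cost (While e c)) + (1 + cost e)" "Q s2"
        by blast
      have "exec W (While e c) s (1 + cost e + t1 + t2) s2"
        using fits[OF less.prems] False 1(1) 2(1) by (rule exec.WhileTrue)
      moreover have "1 + cost e + t1 \<le> k * pass_cost (While e c)"
        using 1(2) mult_le_mono1[OF k, of "1 + cost e"] by (simp add: algebra_simps)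
      moreover have "\<mu> s1 * (k * pass_cost (While e c)) + k * pass_cost (While e c) \<le> \<mu> s * (k * pass_cost (While e c))"
        using 1(4) mult_le_mono1[of "Suc (\<mu> s1)" "\<mu> s" "k * pass_cost (While e c)"] by simp
      ultimately show ?thesis using 2(2,3) by (intro exI[of _ "1 + cost e + t1 + t2"] exI[of _ s2]) auto
    qed
  qed
  then obtain t s' where t: "exec W (While e c) s t s'"
    "t \<le> \<mu> s * (k * pass_cost (While e c)) + (1 + cost e)" "Q s'" by blast
  have "1 + cost e \<le> k * pass_cost (While e c)"
    using mult_le_mono1[OF k, of "1 + cost e"] by (simp add: algebra_simps)
  then have "t \<le> (\<mu> s + 1) * k * pass_cost (While e c)" using t(2) by (simp add: algebra_simps)
  also have "\<dots> \<le> K * pass_cost (While e c)" using bound by (rule mult_le_mono1)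
  finally show ?thesis using t unfolding run_def by blast
qed

text \<open>Multiplication by \<open>2 ^ n\<close> through additions alone. The expression contains
  \<open>2 ^ n\<close> copies of \<open>e\<close>, but it is only used with the fixed
  \<open>n = p\<close>, so its cost is a constant.\<close>

fun dbl :: "nat \<Rightarrow> expr \<Rightarrow> expr" where
  "dbl 0 e = e"
| "dbl (Suc n) e = Add (dbl n e) (dbl n e)"

lemma eval_dbl [simp]: "eval_expr (dbl n e) s = 2 ^ n * eval_expr e s"
  by (induction n) simp_all

lemma fits_imp_le: "fits W e s \<Longrightarrow> eval_expr e s \<le> W"
  by (induction e) auto

lemma fits_dbl [simp]: "fits W (dbl n e) s \<longleftrightarrow> fits W e s \<and> 2 ^ n * eval_expr e s \<le> W"
proof (induction n)
  case 0
  then show ?case using fits_imp_le by auto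
qed auto

abbreviation var :: "nat \<Rightarrow> expr" where "var x \<equiv> Cell x (Const 0)"
abbreviation set_var :: "nat \<Rightarrow> expr \<Rightarrow> prog" where "set_var x e \<equiv> Assign x (Const 0) e"

text \<open>The variables \<open>h\<close> and \<open>a\<close> hold the quotient and the remainder of a counter by \<open>b\<close>; there is no
  division on the machine.\<close>

definition incr :: "nat \<Rightarrow> nat \<Rightarrow> expr \<Rightarrow> prog" where
  "incr h a b =
    Seq (set_var a (Add (var a) (Const 1)))
      (If (Sub b (var a)) Skip (Seq (set_var h (Add (var h) (Const 1))) (set_var a (Const 0))))"

lemma wp_incr:
  assumes "h \<noteq> a" and s: "s h 0 = c div n" "s a 0 = c mod n" and "0 < n"
    and b: "\<And>v. eval_expr b (s(a := (s a)(0 := v))) = n" "\<And>v. fits W b (s(a := (s a)(0 := v)))"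
    and W: "c < W"
    and Q: "Q (s(a := (s a)(0 := Suc c mod n), h := (s h)(0 := Suc c div n)))"
  shows "wp W (incr h a b) Q s"
proof -
  have mod: "c mod n < W" "c div n < W"
    using W by (meson div_le_dividend mod_less_eq_dividend le_less_trans)+
  show ?thesis
  proof (cases "Suc (c mod n) = n")
    case True
    then have "Suc c mod n = 0" "Suc c div n = Suc (c div n)" by (simp_all add: mod_Suc div_Suc)
    with True show ?thesis using assms mod
      by (simp add: incr_def fun_upd_twist)
  next
    case False
    then have "Suc c mod n = Suc (c mod n)" "Suc c div n = c div n"
      by (simp_all add: mod_Suc div_Suc)
    moreover have "Suc (c mod n) < n" using False \<open>0 < n\<close> mod_less_divisor[of n c] by linarith
    moreover have "(s h)(0 := c div n) = s h" using s by (simp add: fun_upd_idem)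
    ultimately show ?thesis using assms mod
      by (auto simp add: incr_def fun_upd_twist fun_upd_idem)
  qed
qed

definition same_outside :: "nat set \<Rightarrow> memory \<Rightarrow> memory \<Rightarrow> bool" where
  "same_outside X s' s \<longleftrightarrow> (\<forall>x. x \<notin> X \<longrightarrow> s' x = s x)"

lemma same_outside_refl [simp]: "same_outside X s s"
  by (simp add: same_outside_def)

lemma same_outside_upd [simp]: "x \<in> X \<Longrightarrow> same_outside X (s'(x := f)) s \<longleftrightarrow> same_outside X s' s"
  by (auto simp: same_outside_def)

lemma same_outsideD: "same_outside X s' s \<Longrightarrow> x \<notin> X \<Longrightarrow> s' x = s x"
  by (simp add: same_outside_def)

abbreviation "N_e \<equiv> Cell 0 (Const 0)"

definition for_prog :: "expr \<Rightarrow> prog \<Rightarrow> prog" where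
  "for_prog e c =
    Seq (set_var 20 (Const 0))
      (While (Sub e (var 20)) (Seq c (set_var 20 (Add (var 20) (Const 1)))))"

lemma wp_mono: "wp W c R s \<Longrightarrow> (\<And>s. R s \<Longrightarrow> R' s) \<Longrightarrow> wp W c R' s"
proof (induction c arbitrary: R R' s)
  case (Assign x i e)
  then show ?case unfolding wp.simps by blast
next
  case (Seq c1 c2)
  have "wp W c1 (wp W c2 R) s" using Seq.prems(1) by simp
  then have "wp W c1 (wp W c2 R') s" by (rule Seq.IH(1)) (rule Seq.IH(2)[OF _ Seq.prems(2)])
  then show ?case by simp
next
  case (If e c1 c2)
  show ?case
    using If.prems(1) If.IH(1)[OF _ If.prems(2)] If.IH(2)[OF _ If.prems(2)] by auto
next
  case (While e c)
  show ?case using While.prems(1) by simp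
next
  case Skip
  then show ?case unfolding wp.simps by blast
qed

text \<open>\<open>J\<close> is indexed by the counter value and must survive any change of array
  20, because the counter is increased after the body has established
  \<open>J (Suc i)\<close>.\<close>

lemma run_for:
  assumes upd: "\<And>i s f. J i s \<Longrightarrow> J i (s(20 := f))"
    and start: "J 0 s"
    and e: "\<And>i s. J i s \<Longrightarrow> fits W e s \<and> eval_expr e s = n"
    and step: "\<And>i s. J i s \<Longrightarrow> i < n \<Longrightarrow> s 20 0 = i \<Longrightarrow>
      wp W c (\<lambda>s'. s' 20 0 = i \<and> J (Suc i) s') s"
    and post: "\<And>s. J n s \<Longrightarrow> Q s"
    and n: "n < W" "n + 2 \<le> K"
  shows "run W K (for_prog e c) s Q"
proof -
  let ?c = "Seq c (set_var 20 (Add (var 20) (Const 1)))"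
  have "run W K (While (Sub e (var 20)) ?c) s0 Q" if "J 0 s0 \<and> s0 20 0 = 0" for s0
  proof (rule run_While[where I = "\<lambda>s. J (s 20 0) s \<and> s 20 0 \<le> n" and \<mu> = "\<lambda>s. n - s 20 0" and k = 1])
    show "J (s0 20 0) s0 \<and> s0 20 0 \<le> n" using that by simp
    show "fits W (Sub e (var 20)) s" if "J (s 20 0) s \<and> s 20 0 \<le> n" for s
      using that e n by auto
    show "run W 1 ?c s (\<lambda>s'. (J (s' 20 0) s' \<and> s' 20 0 \<le> n) \<and> n - s' 20 0 < n - s 20 0)"
      if I: "J (s 20 0) s \<and> s 20 0 \<le> n" and c: "eval_expr (Sub e (var 20)) s \<noteq> 0" for s
    proof (rule run_wp)
      have i: "s 20 0 < n" using I c e[of "s 20 0" s] by simp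
      have "wp W c (wp W (set_var 20 (Add (var 20) (Const 1)))
          (\<lambda>s'. (J (s' 20 0) s' \<and> s' 20 0 \<le> n) \<and> n - s' 20 0 < n - s 20 0)) s"
      proof (rule wp_mono[OF step])
        show "J (s 20 0) s" using I by simp
      qed (use i n in \<open>simp_all add: upd\<close>)
      then show "wp W ?c (\<lambda>s'. (J (s' 20 0) s' \<and> s' 20 0 \<le> n) \<and> n - s' 20 0 < n - s 20 0) s"
        by simp
    qed simp
    show "Q s" if "J (s 20 0) s \<and> s 20 0 \<le> n" and "eval_expr (Sub e (var 20)) s = 0" for s
      using that e[of "s 20 0" s] post[of s] by auto
  qed (use n in auto)
  moreover have "J 0 (s(20 := (s 20)(0 := 0)))" using upd[OF start] .
  ultimately show ?thesis
    unfolding for_prog_def using n by (intro run_Seq run_wp) auto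
qed

section \<open>The decision procedure\<close>

text \<open>
  Memory layout, beyond the input: array 4 is the parity table \<open>tm\<close>; 5 the states reached on the
  numbers up to \<open>3 P N\<close>; 6 and 7, in round \<open>j\<close> of the search, the function \<open>zeros j\<close> and the
  characteristic function of \<open>hit j\<close>; 8 the table \<open>sig m\<close>; 9 the row offsets of 12; 10 and 11 the queue of pairs; 12 the marks of
  the queued pairs. Variables: 20 is the loop counter, and 21, 22 its quotient and remainder by some base;
  23 is the multiplier \<open>m\<close>, 24 the number of remaining rounds, 25 the flag \<open>z\<close>, 26 the end of the queue.
\<close>

definition tm_body :: prog where
  "tm_body =
    Seq (Assign 4 (Add (var 20) (var 20)) (Cell 4 (var 20)))
      (Assign 4 (Add (Add (var 20) (var 20)) (Const 1)) (Sub (Const 1) (Cell 4 (var 20))))"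

text \<open>Round \<open>i\<close> fills entries \<open>2 * i\<close> and \<open>2 * i + 1\<close>,
  so \<open>2 ^ p\<close> rounds give \<open>2 * 2 ^ p\<close> parities. These cover the quotients
  by \<open>m\<close> of all numbers below \<open>2 ^ p * (2 * m)\<close>, the domain of the table
  of \<open>sig m\<close>.\<close>

definition tm_prog :: "nat \<Rightarrow> prog" where
  "tm_prog p = for_prog (Const (2 ^ p)) tm_body"

definition st_body :: "nat \<Rightarrow> prog" where
  "st_body p =
    Seq (Assign 5 (var 20) (Cell 1 (Add (dbl p (Cell 5 (var 21))) (var 22))))
      (incr 21 22 (Const (2 ^ p)))"

definition st_prog :: "nat \<Rightarrow> prog" where
  "st_prog p =
    Seq (Seq (Assign 5 (Const 0) (Cell 0 (Const 1)))
        (Seq (set_var 21 (Const 0)) (set_var 22 (Const 0))))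
      (for_prog (Add (Add (dbl p N_e) (Add (dbl p N_e) (dbl p N_e))) (Const 1)) (st_body p))"

definition init_prog :: prog where
  "init_prog =
    for_prog N_e (Seq (Assign 6 (var 20) (var 20)) (Assign 7 (var 20) (Const 0)))"

text \<open>The scan goes downwards and overwrites variable 23 at each success, so what remains is
  the least candidate. Multiplier 0 is not scanned, which leaves the value 0 free to signal
  failure.\<close>

definition scan_body :: prog where
  "scan_body =
    Seq (If (Cell 2 (Cell 6 (Cell 5 (Add (var 29) (Add (var 29) (var 29))))))
        (set_var 23 (var 29)) Skip)
      (set_var 29 (Sub (var 29) (Const 1)))"

definition scan_prog :: "nat \<Rightarrow> prog" where
  "scan_prog p = Seq (set_var 29 (dbl p N_e)) (While (var 29) scan_body)"

text \<open>With truncated subtraction, \<open>u + (v - u)\<close> is the disjunction of two bits.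
  Array 7 is updated before array 6 because it has to record acceptance after the old number of
  zeros.\<close>

definition shift_body :: "nat \<Rightarrow> prog" where
  "shift_body p =
    Seq (Assign 7 (var 20)
        (Add (Cell 7 (var 20)) (Sub (Cell 2 (Cell 6 (var 20))) (Cell 7 (var 20)))))
      (Assign 6 (var 20) (Cell 1 (dbl p (Cell 6 (var 20)))))"

definition search_body :: "nat \<Rightarrow> prog" where
  "search_body p =
    Seq (scan_prog p)
      (If (var 23) (set_var 24 (Const 0))
        (Seq (for_prog N_e (shift_body p)) (set_var 24 (Sub (var 24) (Const 1)))))"

definition search_prog :: "nat \<Rightarrow> prog" where
  "search_prog p =
    Seq (Seq (set_var 23 (Const 0)) (set_var 24 N_e)) (While (var 24) (search_body p))"

text \<open>After a failed search, 1 serves as a dummy multiplier that keeps the second automaton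
  well defined and small; the flag makes the comparison with it void.\<close>

definition flag_prog :: prog where
  "flag_prog =
    If (var 23) (set_var 25 (Const 0)) (Seq (set_var 23 (Const 1)) (set_var 25 (Const 1)))"

definition sig_body :: prog where
  "sig_body =
    Seq (If (Cell 4 (var 21)) (Assign 8 (var 20) (Add (var 22) (var 23)))
        (Assign 8 (var 20) (var 22)))
      (incr 21 22 (var 23))"

text \<open>One entry for every \<open>b * 2 ^ p + a\<close> with a code \<open>b < 2 * m\<close>
  and a digit \<open>a\<close>: by \<open>sig_step\<close> this is the transition table of the
  automaton of the multiplier.\<close>

definition sig_prog :: "nat \<Rightarrow> prog" where
  "sig_prog p =
    Seq (Seq (set_var 21 (Const 0)) (set_var 22 (Const 0)))
      (for_prog (dbl p (Add (var 23) (var 23))) sig_body)"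

definition base_prog :: prog where
  "base_prog =
    Seq (Assign 9 (Const 0) (Const 0))
      (for_prog N_e
        (Assign 9 (Add (var 20) (Const 1)) (Add (Cell 9 (var 20)) (Add (var 23) (var 23)))))"

text \<open>The answer bit is reduced by the number of violations found. With \<open>f\<close> the
  acceptance bit and \<open>e = 1 - b\<close> the bit for code 0, \<open>(f - e) + (e - f)\<close>
  is their absolute difference, and subtracting the flag cancels it. Subtracting
  \<open>1 - a\<close> from the bit of \<open>hit\<close> cancels that bit exactly when the digit is
  0.\<close>

definition answer_prog :: prog where
  "answer_prog =
    set_var 3 (Sub (var 3)
      (Add (Sub (Add (Sub (Cell 2 (Cell 6 (Cell 10 (var 21)))) (Sub (Const 1) (Cell 11 (var 21))))
                     (Sub (Sub (Const 1) (Cell 11 (var 21))) (Cell 2 (Cell 6 (Cell 10 (var 21))))))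
                (var 25))
           (Sub (Cell 7 (var 27)) (Sub (Const 1) (var 22)))))"

lemma wp_answer_prog:
  assumes s: "s 21 0 = h" "s 22 0 = a" "s 10 h = u" "s 6 u = g" "s 2 g = of_bool F" "s 11 h = b"
      "s 25 0 = zz" "s 27 0 = t" "s 7 t = of_bool H" "s 3 0 = of_bool X"
    and W: "h \<le> W" "a \<le> W" "u \<le> W" "g \<le> W" "b \<le> W" "t \<le> W" "3 \<le> W" and "zz \<le> 1"
    and Q: "Q (s(3 := (s 3)(0 :=
      of_bool (X \<and> (zz \<noteq> 0 \<or> (F \<longleftrightarrow> b = 0)) \<and> (a \<noteq> 0 \<longrightarrow> \<not> H)))))"
  shows "wp W answer_prog Q s"
proof -
  define f e x k :: nat where "f = of_bool F" and "e = 1 - b" and "x = of_bool X" and "k = of_bool H"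
  have le: "f \<le> 1" "e \<le> 1" "x \<le> 1" "k \<le> 1" by (simp_all add: f_def e_def x_def k_def)
  have "x - ((f - e) + (e - f) - zz + (k - (1 - a))) =
      of_bool (X \<and> (zz \<noteq> 0 \<or> (F \<longleftrightarrow> b = 0)) \<and> (a \<noteq> 0 \<longrightarrow> \<not> H))"
    using \<open>zz \<le> 1\<close>
    by (cases X; cases F; cases H; cases "b = 0"; cases "a = 0"; cases "zz = 0")
      (auto simp: f_def e_def x_def k_def)
  moreover have "f \<le> W" "e \<le> W" "x \<le> W" "k \<le> W" "zz \<le> W" "1 \<le> W" "0 \<le> W"
      "(f - e) + (e - f) \<le> W" "(f - e) + (e - f) - zz + (k - (1 - a)) \<le> W"
    using le W(7) \<open>zz \<le> 1\<close> by linarith+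
  ultimately show ?thesis
    using Q W unfolding answer_prog_def wp.simps fits.simps eval_expr.simps s
      f_def[symmetric] e_def[symmetric] x_def[symmetric] k_def[symmetric]
    by metis
qed

text \<open>A single counter runs through all transitions, with the queue position as its quotient
  by \<open>2 ^ p\<close> and the digit as its remainder. The successor is always written behind the
  end of the queue, and the end advances by 1 minus its mark; a known pair is simply overwritten
  later.\<close>

definition bfs_body :: "nat \<Rightarrow> prog" where
  "bfs_body p =
    Seq (set_var 27 (Cell 1 (Add (dbl p (Cell 10 (var 21))) (var 22))))
    (Seq (set_var 28 (Cell 8 (Add (dbl p (Cell 11 (var 21))) (var 22))))
    (Seq answer_prog
    (Seq (Assign 10 (var 26) (var 27))
    (Seq (Assign 11 (var 26) (var 28))
    (Seq (set_var 29 (Add (Cell 9 (var 27)) (var 28)))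
    (Seq (set_var 26 (Add (var 26) (Sub (Const 1) (Cell 12 (var 29)))))
    (Seq (Assign 12 (var 29) (Const 1))
    (Seq (set_var 20 (Add (var 20) (Const 1)))
      (incr 21 22 (Const (2 ^ p)))))))))))"

definition bfs_init :: prog where
  "bfs_init =
    Seq (set_var 3 (Cell 2 (Cell 0 (Const 1))))
    (Seq (Assign 10 (Const 0) (Cell 0 (Const 1)))
    (Seq (Assign 11 (Const 0) (Const 0))
    (Seq (Assign 12 (Cell 9 (Cell 0 (Const 1))) (Const 1))
    (Seq (set_var 26 (Const 1))
    (Seq (set_var 20 (Const 0)) (Seq (set_var 21 (Const 0)) (set_var 22 (Const 0))))))))"

definition bfs_prog :: "nat \<Rightarrow> prog" where
  "bfs_prog p = Seq bfs_init (While (Sub (dbl p (var 26)) (var 20)) (bfs_body p))"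

definition main_prog :: "nat \<Rightarrow> prog" where
  "main_prog p =
    Seq (tm_prog p) (Seq (st_prog p) (Seq init_prog (Seq (search_prog p) (Seq flag_prog
      (Seq (sig_prog p) (Seq base_prog (bfs_prog p)))))))"

lemma mult_add_inject:
  fixes b b' n t t' :: nat
  assumes "b < n" "b' < n" "t * n + b = t' * n + b'"
  shows "t = t' \<and> b = b'"
proof -
  have "(t * n + b) div n = t" "(t' * n + b') div n = t'" using assms(1,2) by simp_all
  then show ?thesis using assms(3) by (metis add_left_cancel)
qed

section \<open>Correctness and running time\<close>

text \<open>The largest numbers needed are the transition count and the table indices, at most about
  \<open>2 * (P * N) ^ 2\<close>, so the constant 10 leaves ample room for sums.\<close>

locale machine = recognizer +
  fixes W :: nat
  assumes W: "10 * ((P * N) * (P * N)) \<le> W"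
begin

abbreviation "M \<equiv> P * N"
text \<open>The constant 4 comes from the search: at most \<open>N + 1\<close> guard tests, each
  weighted by the \<open>M + 1\<close> of a round, with both factors at most
  \<open>2 * M\<close>.\<close>

abbreviation "K \<equiv> 4 * (M * M)"

lemma M_bounds: "2 \<le> M" "P \<le> M" "N \<le> M" "M \<le> M * M"
proof -
  show "P \<le> M" "N \<le> M" using N_pos P_ge_2 by simp_all
  then show "2 \<le> M" using P_ge_2 by linarith
  then show "M \<le> M * M" by simp
qed

lemma W_bounds: "10 * M \<le> W" "10 * P \<le> W" "10 * N \<le> W" "20 \<le> W"
  using M_bounds W by linarith+

lemma W_simps [simp]: "P \<le> W" "P < W" "N \<le> W" "N < W" "M \<le> W" "M < W"
  "Suc 0 \<le> W" "Suc 0 < W" "0 < W"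
  using M_bounds W_bounds by linarith+

lemma K_pos: "1 \<le> K" "P + 2 \<le> K" "N + 2 \<le> K"
proof -
  have "2 * M \<le> M * M" using M_bounds(1) by (rule mult_le_mono1)
  then show "1 \<le> K" "P + 2 \<le> K" "N + 2 \<le> K" using M_bounds by linarith+
qed

lemma table_bounds:
  assumes "m \<le> M"
  shows "P * (2 * m) \<le> 2 * (M * M)" "N * (2 * m) \<le> 2 * (M * M)"
proof -
  have "P * m \<le> M * M" "N * m \<le> M * M"
    by (rule mult_le_mono[OF M_bounds(2) assms]) (rule mult_le_mono[OF M_bounds(3) assms])
  then show "P * (2 * m) \<le> 2 * (M * M)" "N * (2 * m) \<le> 2 * (M * M)" by simp_all
qed

definition inp :: "memory \<Rightarrow> bool" where
  "inp s \<longleftrightarrow> (\<forall>x<3. s x = input_memory p A x)"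

lemma inp_same: "inp s \<Longrightarrow> same_outside X s' s \<Longrightarrow> X \<inter> {..<3} = {} \<Longrightarrow> inp s'"
  unfolding inp_def same_outside_def by (metis disjoint_iff lessThan_iff)

lemma inp_N: "inp s \<Longrightarrow> s 0 0 = N"
  and inp_init: "inp s \<Longrightarrow> s 0 (Suc 0) = init A"
  by (simp_all add: inp_def input_memory_def)

lemma inp_final: "inp s \<Longrightarrow> s 2 q = of_bool (q \<in> final A)"
  using rec by (auto simp: inp_def input_memory_def recognizes_def wf_dfa_def)

lemma inp_delta:
  assumes "inp s" "q < N" "a < P"
  shows "s (Suc 0) (P * q + a) = delta A q a"
proof -
  have "P * q + a < P * (q + 1)" using assms by simp
  also have "\<dots> \<le> P * N" using assms by (intro mult_le_mono2) simp
  finally show ?thesis using assms by (simp add: inp_def input_memory_def mult.commute)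
qed

lemma index_less: "q < N \<Longrightarrow> a < P \<Longrightarrow> P * q + a < M"
  by (metis add_less_cancel_left mult_Suc_right mult_le_mono2 Suc_leI add.commute order_less_le_trans)

section \<open>The tables of parities and of reached states\<close>

lemma tm_prog_correct:
  assumes "s 4 0 = 0"
  shows "run W K (tm_prog p) s (\<lambda>s'. same_outside {4, 20} s' s \<and> (\<forall>j<2 * P. s' 4 j = tm j))"
  unfolding tm_prog_def
\<comment> \<open>The \<open>max 1\<close> accounts for round 0, which reads entry 0 before any
  write; this entry is correct because memory starts out as 0.\<close>
proof (rule run_for[where n = P and
      J = "\<lambda>i s'. same_outside {4, 20} s' s \<and> (\<forall>j<max 1 (2 * i). s' 4 j = tm j)"])
  fix i s'
  assume I: "same_outside {4, 20} s' s \<and> (\<forall>j<max 1 (2 * i). s' 4 j = tm j)" and i: "i < P" "s' 20 0 = i"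
  have tm: "s' 4 i = tm i" using I i by auto
  have "tm j = (if j = 2 * i then tm i else if j = Suc (2 * i) then 1 - tm i else s' 4 j)"
    if "j < 2 * Suc i" for j
    using that I by (cases "j < 2 * i") (auto simp: tm_double tm_Suc_double less_Suc_eq)
  moreover have "tm i \<le> W" using tm_le_1[of i] W_bounds by linarith
  ultimately show "wp W tm_body (\<lambda>s''. s'' 20 0 = i \<and> same_outside {4, 20} s'' s \<and>
      (\<forall>j<max 1 (2 * Suc i). s'' 4 j = tm j)) s'"
    using I W_bounds i tm unfolding tm_body_def by (auto simp: mult_2)
qed (use assms W_bounds M_bounds K_pos in auto)

text \<open>The word is left open because leading zeros may lead to different states for the same
  value: round 0 replaces \<open>init A\<close> at entry 0 by the state after the word
  \<open>[0]\<close>. Acceptance after further zeros depends on the value alone.\<close>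

definition st_ok :: "memory \<Rightarrow> nat \<Rightarrow> bool" where
  "st_ok s x \<longleftrightarrow> (\<exists>w\<in>words. val p w = x \<and> s 5 x = reach w)"

lemma st_prog_correct:
  assumes "inp s"
  shows "run W K (st_prog p) s (\<lambda>s'. same_outside {5, 20, 21, 22} s' s \<and> (\<forall>x\<le>3 * M. st_ok s' x))"
  unfolding st_prog_def
proof (rule run_Seq, rule run_wp)
  let ?J = "\<lambda>y s'. same_outside {5, 20, 21, 22} s' s \<and> s' 21 0 = y div P \<and> s' 22 0 = y mod P \<and>
      (\<forall>x<max 1 y. st_ok s' x)"
  have inp: "inp s'" if "?J y s'" for y s'
    using that inp_same[OF assms, of "{5, 20, 21, 22}" s'] by simp
  have loop: "run W K (for_prog (Add (Add (dbl p N_e) (Add (dbl p N_e) (dbl p N_e))) (Const 1)) (st_body p)) s0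
      (\<lambda>s'. same_outside {5, 20, 21, 22} s' s \<and> (\<forall>x\<le>3 * M. st_ok s' x))" if "?J 0 s0" for s0
  proof (rule run_for[where n = "3 * M + 1" and J = ?J])
    fix y s' assume J: "?J y s'" and y: "y < 3 * M + 1" "s' 20 0 = y"
    define h a where "h = y div P" and "a = y mod P"
    have a: "a < P" and eq: "h * P + a = y"
      by (simp_all add: h_def a_def div_mult_mod_eq)
    have h: "h < max 1 y"
      using P_ge_2 div_less_dividend[of P y] by (cases "y = 0") (auto simp: h_def)
    have h_le: "h \<le> y" by (simp add: h_def)
    obtain w where w: "w \<in> words" "val p w = h" "s' 5 h = reach w"
      using J h unfolding st_ok_def by blast
    have q: "reach w < N" using w by (simp add: reach_less)
    have delta: "s' (Suc 0) (P * reach w + a) = reach (w @ [a])"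
      using inp_delta[OF inp[OF J] q a] by (simp add: reach_snoc)
    have wa: "w @ [a] \<in> words" "val p (w @ [a]) = y" using w a eq by (auto simp: val_snoc)
    have bounds: "P * reach w + a < M" "reach w \<le> W" "reach (w @ [a]) \<le> W"
      using index_less[OF q a] less_imp_le[OF q] reach_less[OF wa(1)] W_simps(3) by linarith+
    let ?s = "s'(5 := (s' 5)(y := reach (w @ [a])))"
    have ok: "st_ok ?s x" if "x < max 1 (Suc y)" for x
    proof (cases "x = y")
      case True
      show ?thesis unfolding st_ok_def by (rule bexI[of _ "w @ [a]"]) (use wa True in simp_all)
    next
      case False
      with that J show ?thesis by (auto simp: st_ok_def)
    qed
    have "wp W (incr 21 22 (Const P)) (\<lambda>s'. s' 20 0 = y \<and> ?J (Suc y) s') ?s"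
    proof (rule wp_incr[where c = y and n = P])
      show "y < W" using y W_bounds M_bounds by linarith
    qed (use J y ok W_bounds in \<open>auto simp: st_ok_def\<close>)
    then show "wp W (st_body p) (\<lambda>s'. s' 20 0 = y \<and> ?J (Suc y) s') s'"
      using J y w bounds W_bounds M_bounds delta h_le
      unfolding st_body_def by (auto simp flip: h_def a_def)
  next
    fix y s' assume J: "?J y s'"
    show "fits W (Add (Add (dbl p N_e) (Add (dbl p N_e) (dbl p N_e))) (Const 1)) s' \<and>
      eval_expr (Add (Add (dbl p N_e) (Add (dbl p N_e) (dbl p N_e))) (Const 1)) s' = 3 * M + 1"
      using inp_N[OF inp[OF J]] W_bounds M_bounds by auto
  next
    show "3 * M + 1 < W" using W_bounds M_bounds by linarith
    show "3 * M + 1 + 2 \<le> K"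
      using M_bounds mult_le_mono1[OF M_bounds(1), of M] by linarith
  qed (use that in \<open>auto simp: st_ok_def less_Suc_eq_le\<close>)
  have "st_ok (s(5 := (s 5)(0 := init A), 21 := f, 22 := g)) 0" for f g
    unfolding st_ok_def by (rule bexI[of _ "[]"]) auto
  then show "wp W (Seq (Assign 5 (Const 0) (Cell 0 (Const 1)))
      (Seq (set_var 21 (Const 0)) (set_var 22 (Const 0))))
    (\<lambda>s0. run W K (for_prog (Add (Add (dbl p N_e) (Add (dbl p N_e) (dbl p N_e))) (Const 1)) (st_body p)) s0
      (\<lambda>s'. same_outside {5, 20, 21, 22} s' s \<and> (\<forall>x\<le>3 * M. st_ok s' x))) s"
    using inp_init[OF assms] init_less W_bounds unfolding One_nat_def[symmetric]
    by (auto simp del: One_nat_def intro!: loop)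
qed (use K_pos in simp)

section \<open>The search for the multiplier, and the tables depending on the result\<close>

definition zeros_ok :: "nat \<Rightarrow> memory \<Rightarrow> bool" where
  "zeros_ok j s \<longleftrightarrow> (\<forall>q<N. s 6 q = zeros j q \<and> s 7 q = of_bool (hit j q))"

lemma zeros_ok_upd [simp]: "6 \<noteq> x \<Longrightarrow> 7 \<noteq> x \<Longrightarrow> zeros_ok j (s(x := f)) \<longleftrightarrow> zeros_ok j s"
  by (simp add: zeros_ok_def)

lemma init_prog_correct:
  assumes "inp s"
  shows "run W K init_prog s (\<lambda>s'. same_outside {6, 7, 20} s' s \<and> zeros_ok 0 s')"
  unfolding init_prog_def
proof (rule run_for[where n = N and
      J = "\<lambda>i s'. same_outside {6, 7, 20} s' s \<and> (\<forall>q<i. s' 6 q = q \<and> s' 7 q = 0)"])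
  fix i s' assume J: "same_outside {6, 7, 20} s' s \<and> (\<forall>q<i. s' 6 q = q \<and> s' 7 q = 0)"
  have "inp s'" using J inp_same[OF assms, of "{6, 7, 20}" s'] by simp
  then show "fits W N_e s' \<and> eval_expr N_e s' = N" by (simp add: inp_N)
next
  fix i s' assume J: "same_outside {6, 7, 20} s' s \<and> (\<forall>q<i. s' 6 q = q \<and> s' 7 q = 0)"
    and i: "i < N" "s' 20 0 = i"
  have "i \<le> W" using i W_simps(3) by linarith
  then show "wp W (Seq (Assign 6 (var 20) (var 20)) (Assign 7 (var 20) (Const 0)))
    (\<lambda>s'. s' 20 0 = i \<and> same_outside {6, 7, 20} s' s \<and> (\<forall>q<Suc i. s' 6 q = q \<and> s' 7 q = 0)) s'"
    using J i by (simp add: less_Suc_eq)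
qed (use K_pos in \<open>simp_all add: zeros_ok_def hit_def\<close>)

lemma hit_Suc: "hit (Suc j) q \<longleftrightarrow> hit j q \<or> zeros j q \<in> final A"
  by (auto simp: hit_def less_Suc_eq)

text \<open>Updating in place is safe since the new entries of a state depend only on its own old
  ones and on the input; below the counter the arrays describe \<open>Suc j\<close>, from it on
  still \<open>j\<close>.\<close>

lemma shift_correct:
  assumes "inp s" "zeros_ok j s"
  shows "run W (M + 1) (for_prog N_e (shift_body p)) s (\<lambda>s'. same_outside {6, 7, 20} s' s \<and> zeros_ok (Suc j) s')"
proof (rule run_for[where n = N and
      J = "\<lambda>i s'. same_outside {6, 7, 20} s' s \<and>
        (\<forall>q<N. s' 6 q = zeros (if q < i then Suc j else j) q \<and>
          s' 7 q = of_bool (hit (if q < i then Suc j else j) q))"], goal_cases)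
  case (3 i s')
  then have "inp s'" using inp_same[OF assms(1), of "{6, 7, 20}" s'] by simp
  then show ?case by (simp add: inp_N)
next
  case (4 i s')
  then have inp: "inp s'" using inp_same[OF assms(1), of "{6, 7, 20}" s'] by simp
  have z: "zeros j i < N" "zeros (Suc j) i < N" using 4 by (simp_all add: zeros_less)
  have s6: "s' 6 i = zeros j i" and s7: "s' 7 i = of_bool (hit j i)" using 4 by auto
  have delta: "s' (Suc 0) (P * zeros j i) = zeros (Suc j) i"
    using inp_delta[OF inp z(1), of 0] by (simp add: zeros_Suc)
  have "P * zeros j i < M" using index_less[OF z(1), of 0] by simp
  then have bounds: "P * zeros j i \<le> W" "zeros j i \<le> W" "zeros (Suc j) i \<le> W" "i \<le> W"
    using z 4(2) W_simps(3,5) by linarith+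
  show ?case
    using 4 bounds s6 s7 delta inp_final[OF inp]
    by (auto simp: shift_body_def less_Suc_eq hit_Suc)
next
  case 7
  show ?case using N_pos mult_le_mono1[OF P_ge_2, of N] by linarith
qed (use assms in \<open>auto simp: zeros_ok_def\<close>)

definition candidate :: "nat \<Rightarrow> nat \<Rightarrow> bool" where
  "candidate j x \<longleftrightarrow> 3 * x * P ^ j \<in> Y"

definition no_candidate :: "nat \<Rightarrow> bool" where
  "no_candidate j \<longleftrightarrow> (\<forall>x. 1 \<le> x \<and> x \<le> M \<longrightarrow> \<not> candidate j x)"

definition first_candidate :: "nat \<Rightarrow> nat \<Rightarrow> bool" where
  "first_candidate j m \<longleftrightarrow> m \<le> M \<and> candidate j m \<and> (\<forall>x. 1 \<le> x \<and> x < m \<longrightarrow> \<not> candidate j x)"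

lemma scan_correct:
  assumes "inp s" "zeros_ok j s" "\<forall>x\<le>3 * M. st_ok s x" "s 23 0 = 0"
  shows "run W (M + 1) (scan_prog p) s (\<lambda>s'. same_outside {23, 29} s' s \<and>
    (if s' 23 0 = 0 then no_candidate j else first_candidate j (s' 23 0)))"
    (is "run _ _ _ _ ?Q")
  unfolding scan_prog_def
proof (rule run_Seq, rule run_wp)
  \<comment> \<open>Numbers above variable 29 have been tested. Variable 23 is 0 as long as none of
    them was a candidate, and afterwards holds the least one among them.\<close>
  let ?I = "\<lambda>s'. same_outside {23, 29} s' s \<and> s' 29 0 \<le> M \<and>
    (if s' 23 0 = 0 then \<forall>x. s' 29 0 < x \<and> x \<le> M \<longrightarrow> \<not> candidate j x
     else s' 29 0 < s' 23 0 \<and> s' 23 0 \<le> M \<and> candidate j (s' 23 0) \<and>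
       (\<forall>x. s' 29 0 < x \<and> x < s' 23 0 \<longrightarrow> \<not> candidate j x))"
  have loop: "run W (M + 1) (While (var 29) scan_body) s0 ?Q" if "?I s0" for s0
  proof (rule run_While[where I = ?I and \<mu> = "\<lambda>s. s 29 0" and k = 1])
    show "?I s0" by fact
    show "fits W (var 29) s'" if "?I s'" for s'
    proof -
      from that have "s' 29 0 \<le> M" by blast
      then show ?thesis using W_simps(5) by (simp add: le_trans)
    qed
    show "?Q s'" if "?I s'" "eval_expr (var 29) s' = 0" for s'
      using that by (auto simp: no_candidate_def first_candidate_def split: if_splits)
    show "run W 1 scan_body s' (\<lambda>s''. ?I s'' \<and> s'' 29 0 < s' 29 0)"
      if I: "?I s'" and c: "eval_expr (var 29) s' \<noteq> 0" for s'
    proof (rule run_wp)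
      define x where "x = s' 29 0"
      have same: "same_outside {23, 29} s' s" using I by blast
      have inp: "inp s'" using inp_same[OF assms(1) same] by simp
      have x: "0 < x" "x \<le> M" using I c by (auto simp: x_def)
      have xW: "x \<le> W" "x + x \<le> W" "x + (x + x) \<le> W" using x W_bounds by linarith+
      obtain w where w: "w \<in> words" "val p w = 3 * x" "s' 5 (3 * x) = reach w"
        using assms(3)[rule_format, OF mult_le_mono2[OF x(2)]] same_outsideD[OF same, of 5]
        unfolding st_ok_def by auto
      have r: "reach w < N" using w by (simp add: reach_less)
      have s6: "s' 6 (reach w) = zeros j (reach w)"
        using assms(2) r same_outsideD[OF same, of 6] by (simp add: zeros_ok_def)
      have fin: "s' 2 (zeros j (reach w)) = of_bool (candidate j x)"
        using final_zeros_iff[OF w(1), of j] w inp_final[OF inp] by (simp add: candidate_def)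
      have "3 * x = x + (x + x)" by simp
      then have cell: "s' 5 (x + (x + x)) = reach w" using w by metis
      have W: "reach w \<le> W" "zeros j (reach w) \<le> W"
        using r zeros_less[OF r, of j] W_simps(3) by linarith+
      have I': "x \<le> M" "if s' 23 0 = 0 then \<forall>y. x < y \<and> y \<le> M \<longrightarrow> \<not> candidate j y
         else x < s' 23 0 \<and> s' 23 0 \<le> M \<and> candidate j (s' 23 0) \<and>
           (\<forall>y. x < y \<and> y < s' 23 0 \<longrightarrow> \<not> candidate j y)"
        using I unfolding x_def by blast+
      have x': "x - Suc 0 \<le> M" "\<forall>y. x - Suc 0 < y \<and> y < x \<longrightarrow> \<not> candidate j y"
        using x(2) by auto
      show "wp W scan_body (\<lambda>s''. ?I s'' \<and> s'' 29 0 < s' 29 0) s'"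
      proof (cases "candidate j x")
        case True
        then show ?thesis
          using x x' xW W same unfolding scan_body_def
          by (simp add: x_def[symmetric] cell s6 fin)
      next
        case False
        have "x - Suc 0 < y \<longleftrightarrow> x = y \<or> x < y" for y using x(1) by linarith
        then have I'': "if s' 23 0 = 0 then \<forall>y. x - Suc 0 < y \<and> y \<le> M \<longrightarrow> \<not> candidate j y
          else x - Suc 0 < s' 23 0 \<and> s' 23 0 \<le> M \<and> candidate j (s' 23 0) \<and>
            (\<forall>y. x - Suc 0 < y \<and> y < s' 23 0 \<longrightarrow> \<not> candidate j y)"
          using I'(2) False by (auto split: if_splits)
        then show ?thesis
          using x x'(1) xW W same False I'' unfolding scan_body_def
          by (simp add: x_def[symmetric] cell s6 fin)
      qed
    qed simp
    have "s0 29 0 \<le> M" using that by blast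
    then show "(s0 29 0 + 1) * 1 \<le> M + 1" by simp
  qed simp
  have l: "run W (M + 1) (While (var 29) scan_body) (s(29 := (s 29)(0 := M))) ?Q"
    by (rule loop) (use assms(4) in auto)
  show "wp W (set_var 29 (dbl p N_e)) (\<lambda>s0. run W (M + 1) (While (var 29) scan_body) s0 ?Q) s"
    unfolding wp.simps
  proof (intro conjI)
    show "run W (M + 1) (While (var 29) scan_body)
        (s(29 := (s 29)(eval_expr (Const 0) s := eval_expr (dbl p N_e) s))) ?Q"
      using l by (simp only: eval_dbl eval_expr.simps inp_N[OF assms(1)])
  qed (simp_all add: inp_N[OF assms(1)])
qed simp

lemma sig_prog_correct:
  assumes tm: "\<forall>j<2 * P. s 4 j = tm j" and m: "0 < s 23 0" "s 23 0 \<le> M"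
  shows "run W K (sig_prog p) s (\<lambda>s'. same_outside {8, 20, 21, 22} s' s \<and>
    (\<forall>y<P * (2 * s 23 0). s' 8 y = sig (s 23 0) y))"
    (is "run _ _ _ _ ?Q")
  unfolding sig_prog_def
proof (rule run_Seq, rule run_wp)
  define m where "m = s 23 0"
  have m: "0 < m" "m \<le> M" using assms by (simp_all add: m_def)
  have nW: "P * (2 * m) < W" "2 * m \<le> W" "P * (2 * m) + 2 \<le> K"
    using table_bounds[OF m(2)] m(2) W W_bounds M_bounds by linarith+
  let ?J = "\<lambda>y s'. same_outside {8, 20, 21, 22} s' s \<and> s' 21 0 = y div m \<and> s' 22 0 = y mod m \<and>
      (\<forall>x<y. s' 8 x = sig m x)"
  have loop: "run W K (for_prog (dbl p (Add (var 23) (var 23))) sig_body) s0 ?Q" if "?J 0 s0" for s0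
  proof (rule run_for[where n = "P * (2 * m)" and J = ?J], goal_cases)
    case (3 y s')
    then have "s' 23 = s 23" by (simp add: same_outside_def)
    then show ?case using nW by (simp add: m_def[symmetric] mult_2)
  next
    case (4 y s')
    have s: "s' 23 0 = m" "s' 4 = s 4" using 4(1) by (simp_all add: same_outside_def m_def)
    have "y div m < 2 * P"
      using 4(2) m(1) by (simp add: div_less_iff_less_mult algebra_simps)
    then have tm: "s' 4 (y div m) = tm (y div m)" using assms s by simp
    have yW: "y < W" using 4(2) nW by linarith
    have "y mod m < m" "y div m \<le> y" using m by simp_all
    moreover have "tm (y div m) \<le> 1" by (rule tm_le_1)
    ultimately have W: "y mod m \<le> W" "y mod m + m \<le> W" "m \<le> W" "y div m \<le> W" "y \<le> W"
      "tm (y div m) \<le> W"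
      using nW yW by linarith+
    have sig: "sig m y = (if tm (y div m) = 0 then y mod m else y mod m + m)"
      using tm_le_1[of "y div m"] by (auto simp: sig_def le_Suc_eq)
    let ?s = "s'(8 := (s' 8)(y := sig m y))"
    have "wp W (incr 21 22 (var 23)) (\<lambda>s'. s' 20 0 = y \<and> ?J (Suc y) s') ?s"
    proof (rule wp_incr[where c = y and n = m])
      show "y < W" by fact
    qed (use 4 m s W in \<open>simp_all add: less_Suc_eq\<close>)
    then show ?case
      using 4 W s tm sig unfolding sig_body_def by (auto split: if_splits)
  qed (use that nW in \<open>simp_all add: m_def[symmetric]\<close>)
  show "wp W (Seq (set_var 21 (Const 0)) (set_var 22 (Const 0)))
    (\<lambda>s0. run W K (for_prog (dbl p (Add (var 23) (var 23))) sig_body) s0 ?Q) s"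
    by (auto simp del: One_nat_def intro!: loop)
qed (use K_pos in simp)

lemma base_prog_correct:
  assumes "inp s" and m: "s 23 0 \<le> M"
  shows "run W K base_prog s (\<lambda>s'. same_outside {9, 20} s' s \<and> (\<forall>q\<le>N. s' 9 q = q * (2 * s 23 0)))"
    (is "run _ _ _ _ ?Q")
  unfolding base_prog_def
proof (rule run_Seq, rule run_wp)
  define m where "m = s 23 0"
  have m: "m \<le> M" using assms by (simp_all add: m_def)
  have nW: "N * (2 * m) \<le> W"
    using table_bounds[OF m] W by linarith
  let ?J = "\<lambda>y s'. same_outside {9, 20} s' s \<and> (\<forall>q\<le>y. s' 9 q = q * (2 * m))"
  let ?c = "Assign 9 (Add (var 20) (Const 1)) (Add (Cell 9 (var 20)) (Add (var 23) (var 23)))"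
  have loop: "run W K (for_prog N_e ?c) s0 ?Q" if "?J 0 s0" for s0
  proof (rule run_for[where n = N and J = ?J], goal_cases)
    case (3 y s')
    then have "inp s'" using inp_same[OF assms(1), of "{9, 20}" s'] by simp
    then show ?case by (simp add: inp_N)
  next
    case (4 y s')
    have s: "s' 23 0 = m" using 4(1) by (simp_all add: same_outside_def m_def)
    have "Suc y * (2 * m) \<le> N * (2 * m)" using 4(2) by (intro mult_le_mono1) simp
    then have W: "y * (2 * m) + 2 * m \<le> W" using nW by simp
    moreover define v where "v = y * (2 * m)"
    ultimately have "m \<le> W" "m + m \<le> W" "v \<le> W" "v + (m + m) \<le> W" by linarith+
    then have W: "m \<le> W" "m + m \<le> W" "v \<le> W" "v + (m + m) \<le> W" .
    have y: "Suc y \<le> W" "y \<le> W" using 4(2) W_simps(3) by linarith+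
    have "Suc y * (2 * m) = v + (m + m)" "s' 9 y = v" using 4(1) by (simp_all add: v_def)
    moreover from this 4(1)
    have "\<forall>q\<le>Suc y. ((s' 9)(Suc y := v + (m + m))) q = q * (2 * m)"
      by (auto simp only: fun_upd_def le_Suc_eq split: if_splits)
    ultimately show ?case using 4(1,3) s y W by simp
  qed (use that K_pos in \<open>simp_all add: m_def[symmetric]\<close>)
  show "wp W (Assign 9 (Const 0) (Const 0)) (\<lambda>s0. run W K (for_prog N_e ?c) s0 ?Q) s"
    by (auto simp del: One_nat_def intro!: loop)
qed (use K_pos in simp)

lemma search_correct:
  assumes inp: "inp s" and gh: "zeros_ok 0 s" and st: "\<forall>x\<le>3 * M. st_ok s x"
  shows "run W K (search_prog p) s (\<lambda>s'. same_outside {6, 7, 20, 23, 24, 29} s' s \<and>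
    (\<exists>j. zeros_ok j s' \<and> (\<forall>i<j. no_candidate i) \<and>
      (if s' 23 0 = 0 then j = N
       else first_candidate j (s' 23 0))))"
    (is "run _ _ _ _ ?Q")
  unfolding search_prog_def
proof (rule run_Seq, rule run_wp)
  let ?X = "{6, 7, 20, 23, 24, 29} :: nat set"
  \<comment> \<open>While nothing is found, variable 24 counts the \<open>N - j\<close> rounds left.
    Success sets it to 0 without a further shift, so arrays 6 and 7 stay at the exponent
    \<open>j\<close> of the candidate, as the later check requires.\<close>
  define I where "I s' \<longleftrightarrow> same_outside ?X s' s \<and>
    (\<exists>j. zeros_ok j s' \<and> (\<forall>i<j. no_candidate i) \<and>
      (if s' 23 0 = 0 then j \<le> N \<and> s' 24 0 = N - j
       else s' 24 0 = 0 \<and> first_candidate j (s' 23 0)))" for s'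
  have rem: "s' 24 0 \<le> N" if "I s'" for s' using that by (auto simp: I_def split: if_splits)
  have loop: "run W K (While (var 24) (search_body p)) s0 ?Q" if "I s0" for s0
  proof (rule run_While[where I = I and \<mu> = "\<lambda>s. s 24 0" and k = "M + 1"])
    show "I s0" by fact
    show "fits W (var 24) s'" if "I s'" for s'
      using rem[OF that] W_simps(3) by (simp add: le_trans)
    show "?Q s'" if "I s'" "eval_expr (var 24) s' = 0" for s'
    proof -
      from that(1) obtain j where "same_outside ?X s' s" "zeros_ok j s'" "\<forall>i<j. no_candidate i"
        "if s' 23 0 = 0 then j \<le> N \<and> s' 24 0 = N - j
         else s' 24 0 = 0 \<and> first_candidate j (s' 23 0)"
        unfolding I_def by (elim conjE exE)
      then show ?thesis using that(2) by (intro conjI exI[of _ j]) (auto split: if_splits)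
    qed
    show "run W (M + 1) (search_body p) s' (\<lambda>s''. I s'' \<and> s'' 24 0 < s' 24 0)"
      if "I s'" and "eval_expr (var 24) s' \<noteq> 0" for s'
    proof -
      have pos: "0 < s' 24 0" using that by simp
      then obtain j where j: "zeros_ok j s'" "\<forall>i<j. no_candidate i"
          "s' 23 0 = 0" "j \<le> N" "s' 24 0 = N - j" and same: "same_outside ?X s' s"
        using \<open>I s'\<close> unfolding I_def by (auto split: if_splits)
      have inp': "inp s'" using inp_same[OF inp same] by simp
      have "s' 5 = s 5" using same_outsideD[OF same] by simp
      then have st': "\<forall>x\<le>3 * M. st_ok s' x" using st by (simp add: st_ok_def)
      have after: "run W (M + 1) (If (var 23) (set_var 24 (Const 0))
          (Seq (for_prog N_e (shift_body p)) (set_var 24 (Sub (var 24) (Const 1))))) s1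
          (\<lambda>s''. I s'' \<and> s'' 24 0 < s' 24 0)"
        if s1: "same_outside {23, 29} s1 s'" and c: "if s1 23 0 = 0 then no_candidate j
          else first_candidate j (s1 23 0)"
        for s1
      proof (rule run_If)
        have "same_outside ?X s1 s" using s1 same by (simp add: same_outside_def)
        have s1_eqs: "s1 6 = s' 6" "s1 7 = s' 7" "s1 24 = s' 24" using s1 by (simp_all add: same_outside_def)
        have gh1: "zeros_ok j s1" using j(1) s1_eqs by (simp add: zeros_ok_def)
        have inp1: "inp s1" using inp_same[OF inp' s1] by simp
        have "s1 23 0 \<le> M" using c by (cases "s1 23 0 = 0") (auto simp: first_candidate_def)
        then show "fits W (var 23) s1" using W_simps(5) by (simp add: le_trans)
        show "run W (M + 1) (set_var 24 (Const 0)) s1 (\<lambda>s''. I s'' \<and> s'' 24 0 < s' 24 0)"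
          if "eval_expr (var 23) s1 \<noteq> 0"
        proof (rule run_wp)
          have "I (s1(24 := (s1 24)(0 := 0)))"
            unfolding I_def using \<open>same_outside ?X s1 s\<close> gh1 j(2) c that by auto
          then show "wp W (set_var 24 (Const 0)) (\<lambda>s''. I s'' \<and> s'' 24 0 < s' 24 0) s1"
            using pos by simp
        qed simp
        show "run W (M + 1) (Seq (for_prog N_e (shift_body p)) (set_var 24 (Sub (var 24) (Const 1)))) s1
            (\<lambda>s''. I s'' \<and> s'' 24 0 < s' 24 0)" if e: "eval_expr (var 23) s1 = 0"
        proof (rule run_Seq, rule run_mono[OF shift_correct[OF inp1 gh1]])
          fix s2 assume s2: "same_outside {6, 7, 20} s2 s1 \<and> zeros_ok (Suc j) s2"
          have eqs: "s2 23 0 = 0" "s2 24 0 = N - j"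
            using s2 s1_eqs j e by (simp_all add: same_outside_def)
          have "same_outside ?X s2 s" using s2 \<open>same_outside ?X s1 s\<close> by (simp add: same_outside_def)
          moreover have "\<forall>i<Suc j. no_candidate i"
            using j(2) c e by (auto simp: less_Suc_eq)
          moreover have "Suc j \<le> N" using pos j by simp
          ultimately have "I (s2(24 := (s2 24)(0 := N - Suc j)))"
            unfolding I_def using eqs s2 by (auto intro!: exI[of _ "Suc j"])
          moreover have "N - j \<le> W" using W_simps(3) by linarith
          ultimately show "run W (M + 1) (set_var 24 (Sub (var 24) (Const 1))) s2
              (\<lambda>s''. I s'' \<and> s'' 24 0 < s' 24 0)"
            using eqs pos j(5) by (intro run_wp) simp_all
        qed simp
      qed simp
      show ?thesis
        unfolding search_body_def
        by (rule run_Seq, rule run_mono[OF scan_correct[OF inp' j(1) st' j(3)]])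
          (simp, rule after, blast+)
    qed
    show "(s0 24 0 + 1) * (M + 1) \<le> K"
    proof -
      have "s0 24 0 + 1 \<le> 2 * M" "M + 1 \<le> 2 * M" using rem[OF that] M_bounds by linarith+
      then have "(s0 24 0 + 1) * (M + 1) \<le> (2 * M) * (2 * M)" by (rule mult_le_mono)
      then show ?thesis by simp
    qed
  qed simp
  have "I (s(23 := (s 23)(0 := 0), 24 := (s 24)(0 := N)))"
    unfolding I_def using gh by (auto intro!: exI[of _ 0])
  then have "run W K (While (var 24) (search_body p)) (s(23 := (s 23)(0 := 0), 24 := (s 24)(0 := N))) ?Q"
    by (rule loop)
  then show "wp W (Seq (set_var 23 (Const 0)) (set_var 24 N_e))
      (\<lambda>s0. run W K (While (var 24) (search_body p)) s0 ?Q) s"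
    using inp_N[OF inp] unfolding wp.simps by (simp del: split_paired_Ex if_split)
qed (use K_pos in simp)

lemma flag_correct:
  assumes "zeros_ok j s" "\<forall>i<j. no_candidate i"
    "if s 23 0 = 0 then j = N
     else first_candidate j (s 23 0)"
  shows "run W K flag_prog s (\<lambda>s'. same_outside {23, 25} s' s \<and> zeros_ok j s' \<and> s' 25 0 \<le> 1 \<and>
    searched (s' 25 0 \<noteq> 0) (s' 23 0) j \<and> s' 23 0 \<le> M)"
proof (rule run_wp)
  have "s 23 0 \<le> M" using assms(3) by (cases "s 23 0 = 0") (auto simp: first_candidate_def)
  then have "s 23 0 \<le> W" "1 \<le> M" using W_simps(5) M_bounds by linarith+
  then show "wp W flag_prog (\<lambda>s'. same_outside {23, 25} s' s \<and> zeros_ok j s' \<and> s' 25 0 \<le> 1 \<and>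
    searched (s' 25 0 \<noteq> 0) (s' 23 0) j \<and> s' 23 0 \<le> M) s"
    using assms \<open>s 23 0 \<le> M\<close> unfolding flag_prog_def searched_def candidate_def no_candidate_def first_candidate_def by auto
qed (use K_pos in simp)

section \<open>Exploration of the product of the two automata\<close>

definition pairs :: "nat \<Rightarrow> (nat \<times> nat) set" where
  "pairs m = (\<lambda>w. (reach w, sig m (val p w))) ` words"

lemma pairs_less:
  assumes "0 < m" "(t, b) \<in> pairs m"
  shows "t < N" "b < 2 * m"
proof -
  obtain w where "w \<in> words" "t = reach w" "b = sig m (val p w)"
    using assms(2) by (auto simp: pairs_def)
  then show "t < N" "b < 2 * m" using reach_less sig_less[OF assms(1)] by simp_all
qed

definition succ :: "nat \<Rightarrow> nat \<times> nat \<Rightarrow> nat \<Rightarrow> nat \<times> nat" where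
  "succ m x a = (delta A (fst x) a, sig m (snd x * P + a))"

lemma succ_pairs:
  assumes m: "0 < m" and x: "x \<in> pairs m" and a: "a < P"
  shows "succ m x a \<in> pairs m"
proof -
  obtain w where w: "w \<in> words" "x = (reach w, sig m (val p w))" using x by (auto simp: pairs_def)
  then have "succ m x a = (reach (w @ [a]), sig m (val p (w @ [a])))"
    using sig_step[OF m a] by (simp add: succ_def reach_snoc val_snoc)
  moreover have "w @ [a] \<in> words" using w a by simp
  ultimately show ?thesis unfolding pairs_def by blast
qed

text \<open>\<open>f\<close> is the queue, with end \<open>l\<close>; of the \<open>P * l\<close> transitions leaving its elements, the first
  \<open>y\<close> have been followed.\<close>

definition queue_inv :: "nat \<Rightarrow> (nat \<Rightarrow> nat \<times> nat) \<Rightarrow> nat \<Rightarrow> (nat \<Rightarrow> nat) \<Rightarrow> nat \<Rightarrow> bool" where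
  "queue_inv m f l vis y \<longleftrightarrow> 0 < l \<and> f 0 = (init A, 0) \<and> inj_on f {..<l} \<and> f ` {..<l} \<subseteq> pairs m \<and>
    (\<forall>t<N. \<forall>b<2 * m. vis (t * (2 * m) + b) = of_bool ((t, b) \<in> f ` {..<l})) \<and>
    y \<le> P * l \<and> (\<forall>c<y. succ m (f (c div P)) (c mod P) \<in> f ` {..<l})"

definition answer :: "bool \<Rightarrow> nat \<Rightarrow> (nat \<Rightarrow> nat \<times> nat) \<Rightarrow> nat \<Rightarrow> bool" where
  "answer z q f y \<longleftrightarrow> init A \<in> final A \<and>
    (\<forall>c<y. ok z q (fst (f (c div P))) (snd (f (c div P))) (c mod P))"

text \<open>Queued pairs are distinct, hence no more than the states of the product; this bounds
  both the running time and the addresses used.\<close>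

lemma queue_length:
  assumes "0 < m" "queue_inv m f l vis y"
  shows "l \<le> N * (2 * m)"
proof -
  have "f ` {..<l} \<subseteq> {..<N} \<times> {..<2 * m}"
    using assms(2) pairs_less[OF assms(1)] unfolding queue_inv_def by fastforce
  then have "card (f ` {..<l}) \<le> card ({..<N} \<times> {..<2 * m})" by (intro card_mono) auto
  then show ?thesis using assms by (simp add: queue_inv_def card_image)
qed

text \<open>Position \<open>l\<close> lies outside the current queue, so writing \<open>x\<close>
  there affects no transition followed so far. If \<open>x\<close> is already marked, the end stays
  at \<open>l\<close> and the write remains invisible; otherwise \<open>x\<close> becomes the last
  element.\<close>

lemma queue_step:
  assumes m: "0 < m" and inv: "queue_inv m f l vis y" and y: "y < P * l"
    and x: "x = succ m (f (y div P)) (y mod P)" and k: "k = fst x * (2 * m) + snd x"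
  shows "queue_inv m (f(l := x)) (l + (1 - vis k)) (vis(k := 1)) (Suc y)"
    and "answer z q (f(l := x)) (Suc y) \<longleftrightarrow> answer z q f y \<and>
      ok z q (fst (f (y div P))) (snd (f (y div P))) (y mod P)"
proof -
  note inv' = inv[unfolded queue_inv_def]
  have h: "c div P < l" if "c \<le> y" for c
    using that y by (simp add: div_less_iff_less_mult mult.commute)
  have "f (y div P) \<in> pairs m" using h[of y] inv' by blast
  then have xp: "x \<in> pairs m" unfolding x by (rule succ_pairs[OF m]) simp
  then have less: "fst x < N" "snd x < 2 * m" using pairs_less[OF m, of "fst x" "snd x"] by simp_all
  have vis: "vis k = of_bool (x \<in> f ` {..<l})" unfolding k using inv' less by simp
  have k_eq: "t * (2 * m) + b = k \<longleftrightarrow> (t, b) = x" if "b < 2 * m" for t b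
    using mult_add_inject[OF that less(2), of t "fst x"] unfolding k by (auto simp: prod_eq_iff)
  have image: "f(l := x) ` {..<l + (1 - vis k)} = insert x (f ` {..<l})"
  proof (cases "x \<in> f ` {..<l}")
    case True
    then show ?thesis using vis by (auto simp: image_iff)
  next
    case False
    then have "{..<l + (1 - vis k)} = insert l {..<l}" using vis by auto
    then show ?thesis by (auto simp: image_iff)
  qed
  have upd: "(f(l := x)) (c div P) = f (c div P)" if "c \<le> y" for c
    using h[OF that] by simp
  show "queue_inv m (f(l := x)) (l + (1 - vis k)) (vis(k := 1)) (Suc y)"
    unfolding queue_inv_def image
  proof (intro conjI allI impI)
    show "inj_on (f(l := x)) {..<l + (1 - vis k)}"
    proof (cases "x \<in> f ` {..<l}")
      case True
      then show ?thesis using vis inv' by (auto simp: inj_on_def)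
    next
      case False
      then have "{..<l + (1 - vis k)} = insert l {..<l}" using vis by auto
      moreover have "inj_on f {..<l}" using inv' by blast
      ultimately show ?thesis using False by (auto simp: inj_on_def)
    qed
    show "(vis(k := 1)) (t * (2 * m) + b) = of_bool ((t, b) \<in> insert x (f ` {..<l}))"
      if "t < N" "b < 2 * m" for t b
      using inv' that k_eq[OF that(2)] by auto
    have "P * l \<le> P * (l + (1 - vis k))" by simp
    then show "Suc y \<le> P * (l + (1 - vis k))" using y by linarith
    show "succ m ((f(l := x)) (c div P)) (c mod P) \<in> insert x (f ` {..<l})" if "c < Suc y" for c
      using that inv' upd[of c] x by (cases "c = y") auto
  qed (use inv' xp in auto)
  show "answer z q (f(l := x)) (Suc y) \<longleftrightarrow> answer z q f y \<and>
      ok z q (fst (f (y div P))) (snd (f (y div P))) (y mod P)"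
    unfolding answer_def using upd by (auto simp: less_Suc_eq_le le_less)
qed

text \<open>Once all \<open>P * l\<close> transitions have been followed, the queued pairs are
  closed under successors and contain the start, so by \<open>closed_pairs_eq\<close> they are
  exactly the reachable ones. The checks made are then those of \<open>multiple_iff_ok\<close>, with
  \<open>c\<close> standing for the pair of \<open>c div P\<close> and
  \<open>c mod P\<close>.\<close>

lemma queue_done:
  assumes m: "0 < m" and inv: "queue_inv m f l vis y" and y: "P * l \<le> y"
    and searched: "searched z m q"
  shows "answer z q f y \<longleftrightarrow> (\<exists>m. Y = multiples m thue_morse)"
proof -
  note inv' = inv[unfolded queue_inv_def]
  let ?R = "f ` {..<l}"
  have index: "(i * P + a) div P = i" "(i * P + a) mod P = a" "i * P + a < y"
    if "i < l" "a < P" for i a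
  proof -
    show "(i * P + a) div P = i" "(i * P + a) mod P = a" using that by simp_all
    have "i * P + a < Suc i * P" using that by simp
    also have "\<dots> \<le> l * P" using that by (intro mult_le_mono1) simp
    finally show "i * P + a < y" using y by (simp add: mult.commute)
  qed
  have R: "?R = pairs m"
    unfolding pairs_def
  proof (rule closed_pairs_eq[OF m])
    show "(init A, 0) \<in> ?R" using inv' by (metis imageI lessThan_iff)
    show "\<exists>w\<in>words. s = reach w \<and> b = sig m (val p w)" if "(s, b) \<in> ?R" for s b
      using inv' that by (auto simp: pairs_def)
    show "(delta A s a, sig m (b * P + a)) \<in> ?R" if sb: "(s, b) \<in> ?R" and a: "a < P" for s b a
    proof -
      obtain i where i: "i < l" "f i = (s, b)" using sb by auto
      have "succ m (f ((i * P + a) div P)) ((i * P + a) mod P) \<in> ?R"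
        using inv' index(3)[OF i(1) a] by blast
      then show ?thesis using i index[OF i(1) a] by (simp add: succ_def)
    qed
  qed
  have "(\<forall>c<y. ok z q (fst (f (c div P))) (snd (f (c div P))) (c mod P)) \<longleftrightarrow>
      (\<forall>x\<in>?R. \<forall>a<P. ok z q (fst x) (snd x) a)" (is "?L \<longleftrightarrow> ?R'")
  proof
    assume L: ?L
    show ?R'
    proof (intro ballI allI impI)
      fix x a assume "x \<in> ?R" and a: "a < P"
      then obtain i where i: "i < l" "f i = x" by auto
      have "ok z q (fst (f ((i * P + a) div P))) (snd (f ((i * P + a) div P))) ((i * P + a) mod P)"
        using L index(3)[OF i(1) a] by blast
      then show "ok z q (fst x) (snd x) a" using i index[OF i(1) a] by simp
    qed
  next
    assume R': ?R'
    show ?L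
    proof (intro allI impI)
      fix c assume "c < y"
      then have "c < P * l" using inv' by linarith
      then have "c div P < l" by (simp add: div_less_iff_less_mult mult.commute)
      then show "ok z q (fst (f (c div P))) (snd (f (c div P))) (c mod P)" using R' by simp
    qed
  qed
  then show ?thesis
    unfolding answer_def multiple_iff_ok[OF searched] R by (simp add: pairs_def)
qed

lemma bfs_correct:
  assumes inp: "inp s0" and gh: "zeros_ok q s0" and z: "s0 25 0 \<le> 1"
    and searched: "searched (s0 25 0 \<noteq> 0) (s0 23 0) q" and mM: "s0 23 0 \<le> M"
    and sig: "\<forall>y<P * (2 * s0 23 0). s0 8 y = sig (s0 23 0) y"
    and base: "\<forall>t\<le>N. s0 9 t = t * (2 * s0 23 0)" and vis: "\<forall>k. s0 12 k = 0"
  shows "run W K (bfs_prog p) s0 (\<lambda>s. s 3 0 = of_bool (\<exists>m. Y = multiples m thue_morse))"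
    (is "run _ _ _ _ ?Q")
  unfolding bfs_prog_def
proof (rule run_Seq, rule run_wp)
  define m where "m = s0 23 0"
  define zz where "zz = s0 25 0"
  have m: "0 < m" "m \<le> M" using searched mM by (auto simp: searched_def m_def)
  have total: "P * (N * (2 * m)) \<le> 2 * (M * M)"
    using mult_le_mono2[OF m(2), of M] by (simp add: mult_ac)
  let ?X = "{3, 10, 11, 12, 20, 21, 22, 26, 27, 28, 29} :: nat set"
  define qf :: "memory \<Rightarrow> nat \<Rightarrow> nat \<times> nat" where "qf s i = (s 10 i, s 11 i)" for s i
  define I where "I s \<longleftrightarrow> same_outside ?X s s0 \<and> s 21 0 = s 20 0 div P \<and> s 22 0 = s 20 0 mod P \<and>
    queue_inv m (qf s) (s 26 0) (s 12) (s 20 0) \<and> s 3 0 = of_bool (answer (zz \<noteq> 0) q (qf s) (s 20 0))"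
    for s
  let ?e = "Sub (dbl p (var 26)) (var 20)"
  have y_le: "s 20 0 \<le> P * s 26 0" and l_le: "s 26 0 \<le> N * (2 * m)"
    and Pl_le: "P * s 26 0 \<le> 2 * (M * M)" if "I s" for s
  proof -
    show "s 20 0 \<le> P * s 26 0" using that by (simp add: I_def queue_inv_def)
    show l: "s 26 0 \<le> N * (2 * m)" using that queue_length[OF m(1)] by (auto simp: I_def)
    show "P * s 26 0 \<le> 2 * (M * M)" using mult_le_mono2[OF l, of P] total by linarith
  qed
  \<comment> \<open>The end of the queue moves during the loop, so the measure is taken against the
    fixed bound \<open>P * (N * (2 * m))\<close> on the number of transitions instead of the current
    guard value.\<close>
  have loop: "run W K (While ?e (bfs_body p)) s1 ?Q" if "I s1" for s1
  proof (rule run_While[where I = I and \<mu> = "\<lambda>s. P * (N * (2 * m)) - s 20 0" and k = 1])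
    show "I s1" by fact
    show "fits W ?e s" if "I s" for s
    proof -
      have "s 20 0 \<le> W" "P * s 26 0 \<le> W" "s 26 0 \<le> W"
        using y_le[OF that] l_le[OF that] Pl_le[OF that] table_bounds(2)[OF m(2)] W by linarith+
      then show ?thesis by simp
    qed
    show "?Q s" if "I s" "eval_expr ?e s = 0" for s
    proof -
      have "answer (zz \<noteq> 0) q (qf s) (s 20 0) \<longleftrightarrow> (\<exists>m. Y = multiples m thue_morse)"
      proof (rule queue_done[OF m(1)])
        show "queue_inv m (qf s) (s 26 0) (s 12) (s 20 0)" using that(1) by (simp add: I_def)
        show "P * s 26 0 \<le> s 20 0" using that(2) by simp
        show "searched (zz \<noteq> 0) m q" using searched by (simp add: zz_def m_def)
      qed
      moreover have "s 3 0 = of_bool (answer (zz \<noteq> 0) q (qf s) (s 20 0))"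
        using that(1) by (simp only: I_def)
      ultimately show ?thesis by simp
    qed
    show "run W 1 (bfs_body p) s
        (\<lambda>s'. I s' \<and> P * (N * (2 * m)) - s' 20 0 < P * (N * (2 * m)) - s 20 0)"
      (is "run _ _ _ _ ?R")
      if I: "I s" and c: "eval_expr ?e s \<noteq> 0" for s
    proof (rule run_wp)
      define y l where "y = s 20 0" and "l = s 26 0"
      define h a where "h = y div P" and "a = y mod P"
      define s' b' where "s' = s 10 h" and "b' = s 11 h"
      define t b where "t = delta A s' a" and "b = sig m (b' * P + a)"
      define k where "k = t * (2 * m) + b"
      have same: "same_outside ?X s s0" and inv: "queue_inv m (qf s) l (s 12) y"
        and ans: "s 3 0 = of_bool (answer (zz \<noteq> 0) q (qf s) y)"
        and ha: "s 21 0 = h" "s 22 0 = a"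
        using I by (simp_all add: I_def y_def l_def h_def a_def)
      note inv' = inv[unfolded queue_inv_def]
      have y: "y < P * l" using c by (simp add: y_def l_def)
      have a: "a < P" by (simp add: a_def)
      have h: "h < l" using y by (simp add: h_def div_less_iff_less_mult mult.commute)
      have "qf s h \<in> pairs m" using h inv' by blast
      then have sb: "s' < N" "b' < 2 * m"
        using pairs_less[OF m(1), of s' b'] by (simp_all add: qf_def s'_def b'_def)
      have x: "(t, b) = succ m (qf s (y div P)) (y mod P)"
        by (simp add: succ_def qf_def t_def b_def s'_def b'_def h_def a_def)
      have t: "t < N" "b < 2 * m" using sb a m by (simp_all add: t_def b_def delta_less sig_less)
      have "P * b' + a < P * (b' + 1)" using a by simp
      also have "\<dots> \<le> P * (2 * m)" using sb by (intro mult_le_mono2) simp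
      finally have idx_b: "P * b' + a < P * (2 * m)" .
      have "k < (t + 1) * (2 * m)" using t by (simp add: k_def)
      also have "\<dots> \<le> N * (2 * m)" using t by (intro mult_le_mono1) simp
      finally have k_less: "k < N * (2 * m)" .
      have inp_s: "inp s" using inp_same[OF inp same] by simp
      have s_eqs: "s 6 = s0 6" "s 7 = s0 7" "s 8 = s0 8" "s 9 = s0 9" "s 25 0 = zz"
        using same by (simp_all add: same_outside_def zz_def)
      have cells: "s (Suc 0) (P * s' + a) = t" "s 8 (P * b' + a) = b" "s 9 t = t * (2 * m)"
        "s 6 s' = zeros q s'" "s 7 t = of_bool (hit q t)" "s 2 (zeros q s') = of_bool (zeros q s' \<in> final A)"
        using inp_delta[OF inp_s sb(1) a] sig idx_b base t gh sb inp_final[OF inp_s] s_eqs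
        by (simp_all add: zeros_ok_def m_def[symmetric] t_def b_def mult.commute)
      have k1: "s 12 k \<le> 1" using inv' t unfolding k_def by simp
      have size: "2 * m < W" "P * (2 * m) < W" "N * (2 * m) < W" "l < W" "P * l < W"
        using table_bounds[OF m(2)] l_le[OF I] Pl_le[OF I] m(2) W W_bounds M_bounds
        unfolding l_def[symmetric] by linarith+
      have "zeros q s' < N" using sb by (simp add: zeros_less)
      then have bounds: "P * s' + a \<le> W" "P * s' \<le> W" "P * b' + a \<le> W" "P * b' \<le> W" "s' \<le> W" "b' \<le> W"
        "h \<le> W" "a \<le> W" "y \<le> W" "Suc y \<le> W" "l \<le> W" "l + 1 \<le> W" "t \<le> W" "b \<le> W" "k \<le> W"
        "zeros q s' \<le> W" "t * (2 * m) \<le> W" "s 12 k \<le> W" and yW: "y < W"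
        using index_less[OF sb(1) a] idx_b h a y sb t k_less k1 k_def size W_simps by linarith+
      have after: "wp W (incr 21 22 (Const P)) ?R s2"
        if s2: "same_outside ?X s2 s0" "s2 21 0 = h" "s2 22 0 = a" "s2 20 0 = Suc y"
          "s2 10 = (s 10)(l := t)" "s2 11 = (s 11)(l := b)" "s2 26 0 = l + (1 - s 12 k)"
          "s2 12 = (s 12)(k := 1)"
          "s2 3 0 = of_bool (answer (zz \<noteq> 0) q (qf s) y \<and> (zz \<noteq> 0 \<or> (zeros q s' \<in> final A \<longleftrightarrow> b' = 0)) \<and>
             (a \<noteq> 0 \<longrightarrow> \<not> hit q t))" for s2
      proof (rule wp_incr[where c = y and n = P])
        have qf2: "qf s2 = (qf s)(l := (t, b))" using s2 by (auto simp: qf_def fun_eq_iff)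
        have upd: "qf (s2(21 := f, 22 := g)) = qf s2" "qf (s2(22 := g, 21 := f)) = qf s2" for f g
          by (simp_all add: qf_def fun_eq_iff)
        note step = queue_step[OF m(1) inv y x, of k]
        have "queue_inv m (qf s2) (s2 26 0) (s2 12) (Suc y)"
          using step(1) by (simp add: qf2 s2 k_def)
        moreover have "answer (zz \<noteq> 0) q (qf s2) (Suc y) \<longleftrightarrow> answer (zz \<noteq> 0) q (qf s) y \<and>
            (zz \<noteq> 0 \<or> (zeros q s' \<in> final A \<longleftrightarrow> b' = 0)) \<and> (a \<noteq> 0 \<longrightarrow> \<not> hit q t)"
          using step(2)[of "zz \<noteq> 0" q] unfolding qf2
          by (simp add: k_def ok_def h_def[symmetric] a_def[symmetric])
            (simp add: qf_def s'_def b'_def t_def)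
        moreover have "Suc y \<le> P * (N * (2 * m))"
          using y mult_le_mono2[OF l_le[OF I], of P] unfolding l_def by linarith
        ultimately show "?R (s2(22 := (s2 22)(0 := Suc y mod P), 21 := (s2 21)(0 := Suc y div P)))"
          unfolding I_def upd using s2 by (simp add: y_def[symmetric])
      qed (use s2 ha yW in \<open>simp_all add: h_def a_def\<close>)
      have zz1: "zz \<le> 1" using z by (simp add: zz_def)
      \<comment> \<open>Each intermediate memory gets a name, so that the assignments of the body
        are verified one at a time rather than on a deeply nested update.\<close>
      define s1 where "s1 = s(27 := (s 27)(0 := t))"
      define s2 where "s2 = s1(28 := (s 28)(0 := b))"
      define s3 where "s3 = s2(3 := (s 3)(0 := of_bool (answer (zz \<noteq> 0) q (qf s) y \<and>
        (zz \<noteq> 0 \<or> (zeros q s' \<in> final A \<longleftrightarrow> b' = 0)) \<and> (a \<noteq> 0 \<longrightarrow> \<not> hit q t))))"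
      define s4 where "s4 = s3(10 := (s 10)(l := t))"
      define s5 where "s5 = s4(11 := (s 11)(l := b))"
      define s6 where "s6 = s5(29 := (s 29)(0 := k))"
      define s7 where "s7 = s6(26 := (s 26)(0 := l + (1 - s 12 k)))"
      define s8 where "s8 = s7(12 := (s 12)(k := 1))"
      define s9 where "s9 = s8(20 := (s 20)(0 := Suc y))"
      note defs = s1_def s2_def s3_def s4_def s5_def s6_def s7_def s8_def s9_def
      have cur: "s 20 0 = y" "s 26 0 = l" "s 10 h = s'" "s 11 h = b'"
        by (simp_all add: y_def l_def s'_def b'_def)
      have "wp W (incr 21 22 (Const P)) ?R s9"
        by (rule after) (use same ha in \<open>simp_all add: defs\<close>)
      then have 9: "wp W (Seq (set_var 20 (Add (var 20) (Const 1))) (incr 21 22 (Const P))) ?R s8"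
        using bounds by (simp add: s9_def) (simp add: defs cur)
      have 8: "wp W (Assign 12 (var 29) (Const 1)) (\<lambda>r. r = s8) s7"
        using bounds by (simp add: s8_def) (simp add: defs)
      have 7: "wp W (set_var 26 (Add (var 26) (Sub (Const 1) (Cell 12 (var 29))))) (\<lambda>r. r = s7) s6"
        using bounds by (simp add: s7_def) (simp add: defs cur)
      have 6: "wp W (set_var 29 (Add (Cell 9 (var 27)) (var 28))) (\<lambda>r. r = s6) s5"
        using bounds cells by (simp add: s6_def) (simp add: defs k_def)
      have 5: "wp W (Assign 11 (var 26) (var 28)) (\<lambda>r. r = s5) s4"
        using bounds by (simp add: s5_def) (simp add: defs cur)
      have 4: "wp W (Assign 10 (var 26) (var 27)) (\<lambda>r. r = s4) s3"
        using bounds by (simp add: s4_def) (simp add: defs cur)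
      have 3: "wp W answer_prog (\<lambda>r. r = s3) s2"
      proof (rule wp_answer_prog)
        show "s2 21 0 = h" "s2 22 0 = a" "s2 10 h = s'" "s2 6 s' = zeros q s'"
          "s2 2 (zeros q s') = of_bool (zeros q s' \<in> final A)" "s2 11 h = b'" "s2 25 0 = zz" "s2 27 0 = t"
          "s2 7 t = of_bool (hit q t)" "s2 3 0 = of_bool (answer (zz \<noteq> 0) q (qf s) y)"
          using cells ans ha s_eqs by (simp_all add: s1_def s2_def cur)
        show "s2(3 := (s2 3)(0 := of_bool (answer (zz \<noteq> 0) q (qf s) y \<and>
          (zz \<noteq> 0 \<or> (zeros q s' \<in> final A \<longleftrightarrow> b' = 0)) \<and> (a \<noteq> 0 \<longrightarrow> \<not> hit q t)))) = s3"
          by (simp add: s1_def s2_def s3_def)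
      qed (use bounds zz1 W_bounds(4) in simp_all)
      have 2: "wp W (set_var 28 (Cell 8 (Add (dbl p (Cell 11 (var 21))) (var 22)))) (\<lambda>r. r = s2) s1"
        using bounds cells ha by (simp add: s2_def) (simp add: defs cur)
      have 1: "wp W (set_var 27 (Cell 1 (Add (dbl p (Cell 10 (var 21))) (var 22)))) (\<lambda>r. r = s1) s"
        using bounds cells ha by (simp add: s1_def) (simp add: defs cur)
      have seq: "wp W (Seq c1 c2) ?R r" if "wp W c1 (\<lambda>r. r = r') r" "wp W c2 ?R r'" for c1 c2 r r'
        using wp_mono[OF that(1)] that(2) by simp
      show "wp W (bfs_body p) ?R s"
        unfolding bfs_body_def
        by (rule seq[OF 1] seq[OF 2] seq[OF 3] seq[OF 4] seq[OF 5] seq[OF 6] seq[OF 7] seq[OF 8] 9)+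
    qed simp
    have "2 * (M * M) + 1 \<le> K" using M_bounds by linarith
    then have "P * (N * (2 * m)) - s1 20 0 + 1 \<le> K" using total diff_le_self le_trans add_le_mono1 by meson
    then show "(P * (N * (2 * m)) - s1 20 0 + 1) * 1 \<le> K" by simp
  qed simp
  define i where "i = init A"
  have i: "i < N" "s0 0 (Suc 0) = i" "s0 9 i = i * (2 * m)" "s0 2 i = of_bool (i \<in> final A)"
    using init_less inp_init[OF inp] base inp_final[OF inp] by (simp_all add: i_def m_def)
  have "i * (2 * m) \<le> N * (2 * m)" using i(1) by (intro mult_le_mono1) simp
  then have iW: "i * (2 * m) \<le> W" "i \<le> W" using table_bounds(2)[OF m(2)] W i(1) W_simps(3) by linarith+
  have ip: "(i, 0) \<in> pairs m" unfolding pairs_def i_def by (rule image_eqI[of _ _ "[]"]) simp_all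
  have vis1: "((s0 12)(i * (2 * m) := 1)) (t * (2 * m) + b) = of_bool ((t, b) = (i, 0))"
    if "b < 2 * m" for t b
  proof (cases "(t, b) = (i, 0)")
    case False
    \<comment> \<open>The initial pair has code 0, so the address of its mark is the bare row
      offset.\<close>
    then have "t * (2 * m) + b \<noteq> i * (2 * m)" using mult_add_inject[OF that, of 0 t i] m(1) by auto
    then show ?thesis using vis False by simp
  qed simp
  have inv: "queue_inv m f 1 ((s0 12)(i * (2 * m) := 1)) 0" if "f 0 = (i, 0)" for f
  proof -
    have "{..<1::nat} = {0}" by auto
    with that ip vis1 show ?thesis
      unfolding queue_inv_def i_def[symmetric] by (simp del: Pair_inject One_nat_def)
  qed
  have after: "run W K (While ?e (bfs_body p)) s1 ?Q"
    if "same_outside ?X s1 s0" "s1 3 0 = of_bool (i \<in> final A)" "s1 10 0 = i" "s1 11 0 = 0" "s1 26 0 = 1"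
      "s1 20 0 = 0" "s1 21 0 = 0" "s1 22 0 = 0" "s1 12 = (s0 12)(i * (2 * m) := 1)" for s1
    by (rule loop) (use that inv[of "qf s1"] in \<open>simp add: I_def answer_def qf_def i_def\<close>)
  show "wp W bfs_init (\<lambda>s1. run W K (While ?e (bfs_body p)) s1 ?Q) s0"
    unfolding bfs_init_def wp.simps
  proof (intro conjI after)
  qed (use i iW W_simps(7,9) in \<open>simp_all\<close>)
qed (use K_pos in simp)

section \<open>Composition of the phases\<close>

lemma main_correct:
  "run W K (main_prog p) (input_memory p A) (\<lambda>s. s 3 0 = of_bool (\<exists>m. Y = multiples m thue_morse))"
    (is "run _ _ _ ?s ?Q")
proof -
  let ?rest7 = "bfs_prog p"
  let ?rest6 = "Seq base_prog ?rest7"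
  let ?rest5 = "Seq (sig_prog p) ?rest6"
  let ?rest4 = "Seq flag_prog ?rest5"
  let ?rest3 = "Seq (search_prog p) ?rest4"
  let ?rest2 = "Seq init_prog ?rest3"
  let ?rest1 = "Seq (st_prog p) ?rest2"
  have seq: "run W K (Seq c c') s ?Q"
    if "run W K c s R" "\<And>s'. R s' \<Longrightarrow> run W K c' s' ?Q" for c c' s R
    using run_Seq[OF run_mono[OF that(1) order_refl that(2)]] .
  have inp0: "inp ?s" "\<forall>k. ?s 12 k = 0" "?s 4 0 = 0" by (simp_all add: inp_def input_memory_def)
  have "run W K ?rest1 s1 ?Q" if s1: "same_outside {4, 20} s1 ?s \<and> (\<forall>j<2 * P. s1 4 j = tm j)" for s1
  proof -
    have inp1: "inp s1" using s1 inp_same[OF inp0(1), of "{4, 20}" s1] by simp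
    have "run W K ?rest2 s2 ?Q" if s2: "same_outside {5, 20, 21, 22} s2 s1 \<and> (\<forall>x\<le>3 * M. st_ok s2 x)" for s2
    proof -
      have inp2: "inp s2" using s2 inp_same[OF inp1, of "{5, 20, 21, 22}" s2] by simp
      have "run W K ?rest3 s3 ?Q" if s3: "same_outside {6, 7, 20} s3 s2 \<and> zeros_ok 0 s3" for s3
      proof -
        have inp3: "inp s3" using s3 inp_same[OF inp2, of "{6, 7, 20}" s3] by simp
        have "s3 5 = s2 5" using s3 by (simp add: same_outside_def)
        then have st3: "\<forall>x\<le>3 * M. st_ok s3 x" using s2 by (simp add: st_ok_def)
        have "run W K ?rest4 s4 ?Q"
          if same4: "same_outside {6, 7, 20, 23, 24, 29} s4 s3" and j: "zeros_ok j s4" "\<forall>i<j. no_candidate i"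
            "if s4 23 0 = 0 then j = N else first_candidate j (s4 23 0)" for s4 j
        proof -
          have inp4: "inp s4" using inp_same[OF inp3 same4] by simp
          have "run W K ?rest5 s5 ?Q"
            if s5: "same_outside {23, 25} s5 s4 \<and> zeros_ok j s5 \<and> s5 25 0 \<le> 1 \<and>
              searched (s5 25 0 \<noteq> 0) (s5 23 0) j \<and> s5 23 0 \<le> M" for s5
          proof -
            have "s5 4 = s4 4" using s5 by (simp add: same_outside_def)
            also have "s4 4 = s3 4" using same4 by (simp add: same_outside_def)
            also have "s3 4 = s2 4" using s3 by (simp add: same_outside_def)
            also have "s2 4 = s1 4" using s2 by (simp add: same_outside_def)
            finally have tm5: "\<forall>j<2 * P. s5 4 j = tm j" using s1 by simp
            have "s5 12 = s4 12" using s5 by (simp add: same_outside_def)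
            also have "s4 12 = s3 12" using same4 by (simp add: same_outside_def)
            also have "s3 12 = s2 12" using s3 by (simp add: same_outside_def)
            also have "s2 12 = s1 12" using s2 by (simp add: same_outside_def)
            also have "s1 12 = ?s 12" using s1 by (simp add: same_outside_def)
            finally have vis5: "\<forall>k. s5 12 k = 0" using inp0(2) by simp
            have m5: "0 < s5 23 0" "s5 23 0 \<le> M" using s5 by (simp_all add: searched_def)
            have inp5: "inp s5" using s5 inp_same[OF inp4, of "{23, 25}" s5] by simp
            have "run W K ?rest6 s6 ?Q"
              if s6: "same_outside {8, 20, 21, 22} s6 s5 \<and> (\<forall>y<P * (2 * s5 23 0). s6 8 y = sig (s5 23 0) y)" for s6
            proof -
              have eq6: "s6 6 = s5 6" "s6 7 = s5 7" "s6 23 = s5 23" "s6 25 = s5 25" "s6 12 = s5 12"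
                using s6 by (simp_all add: same_outside_def)
              have inp6: "inp s6" using s6 inp_same[OF inp5, of "{8, 20, 21, 22}" s6] by simp
              have m6: "s6 23 0 \<le> M" using m5 eq6 by simp
              have "run W K ?rest7 s7 ?Q"
                if s7: "same_outside {9, 20} s7 s6 \<and> (\<forall>q\<le>N. s7 9 q = q * (2 * s6 23 0))" for s7
              proof (rule bfs_correct)
                have eq7: "s7 6 = s5 6" "s7 7 = s5 7" "s7 23 = s5 23" "s7 25 = s5 25" "s7 12 = s5 12"
                    "s7 8 = s6 8" "s6 23 = s5 23"
                  using s7 eq6 by (simp_all add: same_outside_def)
                show "inp s7" using s7 inp_same[OF inp6, of "{9, 20}" s7] by simp
                show "zeros_ok j s7" using s5 eq7 by (simp add: zeros_ok_def)
                show "s7 25 0 \<le> 1" "searched (s7 25 0 \<noteq> 0) (s7 23 0) j" "s7 23 0 \<le> M"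
                  "\<forall>y<P * (2 * s7 23 0). s7 8 y = sig (s7 23 0) y"
                  "\<forall>t\<le>N. s7 9 t = t * (2 * s7 23 0)" "\<forall>k. s7 12 k = 0"
                  using s5 s6 s7 vis5 unfolding eq7 by simp_all
              qed
              then show ?thesis by (rule seq[OF base_prog_correct[OF inp6 m6]])
            qed
            then show ?thesis by (rule seq[OF sig_prog_correct[OF tm5 m5]])
          qed
          then show ?thesis by (rule seq[OF flag_correct[OF j]])
        qed
        then show ?thesis by (intro seq[OF search_correct[OF inp3 _ st3]]) (use s3 in blast)+
      qed
      then show ?thesis by (rule seq[OF init_prog_correct[OF inp2]])
    qed
    then show ?thesis by (rule seq[OF st_prog_correct[OF inp1]])
  qed
  then show ?thesis unfolding main_prog_def by (rule seq[OF tm_prog_correct[of ?s, OF inp0(3)]])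
qed

end

theorem corollary34:
  fixes p :: nat
  assumes "p > 0"
  shows "\<exists>(c :: prog) (T :: nat \<Rightarrow> nat) (W :: nat \<Rightarrow> nat) (d :: nat).
           decides p (\<lambda>Y. \<exists>m. Y = multiples m thue_morse) c T W \<and>
           (\<lambda>N. real (T N)) \<in> O(\<lambda>N. real N ^ 2) \<and>
           (\<lambda>N. real (W N)) \<in> O(\<lambda>N. real N ^ d)"
proof (intro exI conjI)
  \<comment> \<open>Since \<open>p\<close> is fixed, \<open>2 ^ p\<close> and the pass cost of the
    program are constants. The word bound is quadratic too, so \<open>d\<close> becomes 2.\<close>
  let ?M2 = "\<lambda>N. (2 ^ p * N) * (2 ^ p * N) :: nat"
  let ?T = "\<lambda>N. 4 * ?M2 N * pass_cost (main_prog p)"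
  let ?W = "\<lambda>N. 10 * ?M2 N"
  show "decides p (\<lambda>Y. \<exists>m. Y = multiples m thue_morse) (main_prog p) ?T ?W"
    unfolding decides_def
  proof (intro allI impI)
    fix A Y assume rec: "recognizes p A Y"
    interpret machine p A Y "?W (nstates A)"
      by unfold_locales (use assms rec in simp_all)
    show "\<exists>t s. exec (?W (nstates A)) (main_prog p) (input_memory p A) t s \<and> t \<le> ?T (nstates A) \<and>
        s 3 0 = of_bool (\<exists>m. Y = multiples m thue_morse)"
      using main_correct unfolding run_def .
  qed
  have "(\<lambda>N. real (k * ?M2 N)) \<in> O(\<lambda>N. real N ^ 2)" for k
  proof -
    have "(\<lambda>N. real (k * ?M2 N)) = (\<lambda>N. (real k * 2 ^ p * 2 ^ p) * real N ^ 2)"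
      by (simp add: fun_eq_iff power2_eq_square)
    then show ?thesis by simp
  qed
  from this[of "4 * pass_cost (main_prog p)"] this[of 10]
  show "(\<lambda>N. real (?T N)) \<in> O(\<lambda>N. real N ^ 2)" "(\<lambda>N. real (?W N)) \<in> O(\<lambda>N. real N ^ 2)"
    by (simp_all only: mult_ac)
qed

end
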